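(* Let $P$ be a $d$-polytope with the $V(P)$-pointed triangulation $\mathcal{C}_P$, and let $P(n)$ be the $V(P)$-polytope numbers. Then there are nonnegative integers $a_1,a_2,\ldots,a_{d-1}$ such that, for all $n\ge0$, $$P(n)=\alpha^d(n)+\sum_{i=1}^{d-1}a_i\,\alpha^d(n-i).$$
   Context: A $d$-polytope is a $d$-dimensional convex hull of finitely many points in some $\mathbb{R}^e$. Pointed triangulation: let $\mathbf{c}\mathbf{x}$ be a linear function taking distinct values at distinct vertexes of $P$. For each nonempty face $F$ of $P$ (including $P$) let the apex $\mathbf{v}_F$ be the unique vertex of $F$ at which $\mathbf{c}\mathbf{x}$ attains its minimum on $F$; $V(P)$ denotes this system of apexes. The $V(P)$-pointed triangulation of $P$ is $$\mathcal{C}_P=\{\emptyset\}\cup\big\{conv(\{\mathbf{v}_{G_1},\ldots,\mathbf{v}_{G_k}\}) : 1\le k\le d+1,\ G_1\supsetneq\cdots\supsetneq G_k \text{ nonempty faces of } P,\ \mathbf{v}_{G_i}\notin G_{i+1}\ (1\le i<k)\big\},$$ which is a triangulation of $P$. Polytope numbers: let $\mathcal{F}(P)$ be the set of nonempty faces of $P$, including $P$. With the apexes above, the $V(P)$-polytope numbers $P(n)$ and interior polytope numbers $P(n)^\sharp$ are defined by double induction on $d=\dim P$ and $n\ge0$ (each face is a polytope with the inherited apexes): if $d=0$, $P(0)=P(0)^\sharp=0$ and $P(n)=P(n)^\sharp=1$ for $n\ge1$; if $d\ge1$, $P(0)=0$, $P(1)=1$, $P(0)^\sharp=P(1)^\sharp=0$,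 and for $n\ge2$ $$P(n)=P(n-1)+\sum_{F\in\mathcal{F}(P),\ \mathbf{v}_P\notin F}F(n)^\sharp,\qquad P(n)^\sharp=P(n)-\sum_{F\in\mathcal{F}(P)\setminus\{P\}}F(n)^\sharp .$$ $\alpha^d(n)$ denotes the polytope numbers of a $d$-simplex; explicitly $\alpha^d(n)=\binom{n+d-1}{d}$ for $n\ge1$ and $\alpha^d(n)=0$ for $n\le0$. *)

theory Defs
  imports "HOL-Analysis.Polytope"
begin

definition generic_on :: "'a::euclidean_space \<Rightarrow> 'a set \<Rightarrow> bool" where
  "generic_on c P \<longleftrightarrow> inj_on (\<lambda>v. c \<bullet> v) {v. v extreme_point_of P}"

definition apex :: "'a::euclidean_space \<Rightarrow> 'a set \<Rightarrow> 'a" where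
  "apex c F = (THE v. v extreme_point_of F \<and> (\<forall>x\<in>F. c \<bullet> v \<le> c \<bullet> x))"

text \<open>The library counts the empty set as a face of every set.\<close>

definition nonempty_faces :: "'a::euclidean_space set \<Rightarrow> 'a set set" where
  "nonempty_faces P = {F. F face_of P \<and> F \<noteq> {}}"

definition pointed_triangulation :: "'a::euclidean_space \<Rightarrow> 'a set \<Rightarrow> 'a set set" where
  "pointed_triangulation c P =
     {{}} \<union> {convex hull (apex c ` set Gs) | Gs.
       1 \<le> length Gs \<and> int (length Gs) \<le> aff_dim P + 1 \<and>
       set Gs \<subseteq> nonempty_faces P \<and>
       successively (\<lambda>G H. H \<subset> G \<and> apex c G \<notin> H) Gs}"

lemma apex_unique_exists:
  fixes P :: "'a::euclidean_space set"
  assumes "polytope P" "P \<noteq> {}" "generic_on c P"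
  shows "\<exists>!v. v extreme_point_of P \<and> (\<forall>x\<in>P. c \<bullet> v \<le> c \<bullet> x)"
proof -
  have P: "compact P" "convex P"
    using assms(1) by (auto simp: polytope_imp_compact polytope_imp_convex)
  have "continuous_on P (\<lambda>x. c \<bullet> x)"
    by (intro continuous_intros)
  then obtain m where m: "m \<in> P" "\<And>x. x \<in> P \<Longrightarrow> c \<bullet> m \<le> c \<bullet> x"
    using continuous_attains_inf[OF P(1) assms(2)] by blast
  define F where "F = P \<inter> {x. c \<bullet> x = c \<bullet> m}"
  have F: "F face_of P"
    unfolding F_def using P(2) m(2) by (rule face_of_Int_supporting_hyperplane_ge)
  then have "compact F" "convex F" "F \<noteq> {}"
    using P m(1) face_of_imp_compact face_of_imp_convex by (auto simp: F_def)
  then obtain v where v: "v extreme_point_of F"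
    using extreme_point_exists_convex by blast
  then have "v extreme_point_of P" "v \<in> F"
    using extreme_point_of_face[OF F] by auto
  moreover from this have "\<forall>x\<in>P. c \<bullet> v \<le> c \<bullet> x"
    using m(2) by (auto simp: F_def)
  moreover have "w = v" if "w extreme_point_of P" "\<forall>x\<in>P. c \<bullet> w \<le> c \<bullet> x" for w
  proof -
    have "c \<bullet> w = c \<bullet> v"
      using that calculation by (auto simp: extreme_point_of_def intro: order.antisym)
    then show ?thesis
      using assms(3) that(1) calculation(1) by (auto simp: generic_on_def inj_on_def)
  qed
  ultimately show ?thesis by blast
qed

lemma apex_in:
  assumes "polytope P" "P \<noteq> {}" "generic_on c P"
  shows "apex c P \<in> P"
  using theI'[OF apex_unique_exists[OF assms]] unfolding apex_def extreme_point_of_def by blast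

lemma face_dim_less:
  assumes "polytope P" "F \<in> nonempty_faces P" "F \<noteq> P"
  shows "nat (aff_dim F) < nat (aff_dim P)"
proof -
  have "aff_dim F < aff_dim P"
    using assms face_of_aff_dim_lt polytope_imp_convex by (auto simp: nonempty_faces_def)
  moreover have "0 \<le> aff_dim F"
    using assms(2) aff_dim_negative_iff[of F] by (simp add: nonempty_faces_def not_less[symmetric])
  ultimately show ?thesis by linarith
qed

lemma face_inherits:
  assumes "polytope P" "generic_on c P" "F \<in> nonempty_faces P"
  shows "polytope F" "F \<noteq> {}" "generic_on c F"
  using assms
  by (auto simp: nonempty_faces_def generic_on_def inj_on_def extreme_point_of_face
           intro: face_of_polytope_polytope)

text \<open>
  The value 0 outside the nonempty polytopes on which \<open>c\<close> is generic is junk; it makes the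
  recursion terminate, since only there is \<open>apex c P\<close> known to lie in \<open>P\<close>. The values are integers
  so that the subtraction is not truncated. By \<open>face_inherits\<close>, faces of admissible polytopes are
  admissible.
\<close>

function (sequential)
  polytope_number :: "'a::euclidean_space \<Rightarrow> 'a set \<Rightarrow> nat \<Rightarrow> int" and
  interior_polytope_number :: "'a \<Rightarrow> 'a set \<Rightarrow> nat \<Rightarrow> int"
where
  "polytope_number c P n =
    (if \<not> (polytope P \<and> P \<noteq> {} \<and> generic_on c P) then 0
     else if aff_dim P = 0 then (if n = 0 then 0 else 1)
     else if n = 0 then 0
     else if n = 1 then 1
     else polytope_number c P (n - 1) +
       (\<Sum>F\<in>{F \<in> nonempty_faces P. apex c P \<notin> F}. interior_polytope_number c F n))"
| "interior_polytope_number c P n =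
    (if \<not> (polytope P \<and> P \<noteq> {} \<and> generic_on c P) then 0
     else if aff_dim P = 0 then (if n = 0 then 0 else 1)
     else if n = 0 \<or> n = 1 then 0
     else polytope_number c P n -
       (\<Sum>F\<in>nonempty_faces P - {P}. interior_polytope_number c F n))"
  by pat_completeness auto
termination
proof (relation "measures
    [case_sum (\<lambda>(c, P, n). nat (aff_dim P)) (\<lambda>(c, P, n). nat (aff_dim P)),
     case_sum (\<lambda>(c, P, n). n) (\<lambda>(c, P, n). n),
     case_sum (\<lambda>_. 0) (\<lambda>_. 1)]", goal_cases)
  case (3 c P n F)
  then have "nat (aff_dim F) < nat (aff_dim P)"
    using face_dim_less[of P F] apex_in[of P c] by auto
  then show ?case by simp
next
  case (5 c P n F)
  then have "nat (aff_dim F) < nat (aff_dim P)"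
    using face_dim_less[of P F] by auto
  then show ?case by simp
qed auto

declare polytope_number.simps [simp del] interior_polytope_number.simps [simp del]

definition simplex_number :: "nat \<Rightarrow> int \<Rightarrow> int" where
  "simplex_number d k = (if k \<le> 0 then 0 else int (nat (k + int d - 1) choose d))"

end

theory Submission
  imports Defs
begin

text \<open>
  For \<open>n \<ge> 2\<close> the recursion makes \<open>P(n)\<close> count, over the simplices \<open>S\<close> of the pointed
  triangulation, the compositions of \<open>n - 1\<close> into \<open>|S|\<close> positive parts: these are the grid points
  in the relative interior of \<open>S\<close> when every edge is cut into \<open>n - 1\<close> pieces. Fix a generic point
  \<open>q\<close> of \<open>P\<close> and assign a simplex \<open>S\<close> with relative interior point \<open>x\<close> to the unique
  full-dimensional simplex that contains the points \<open>(1 - e) x + e q\<close> for small \<open>e > 0\<close>. The simplices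
  assigned to \<open>T\<close> are the faces of \<open>T\<close> that contain the set \<open>R(T)\<close> of vertices at which
  the barycentric coordinate of \<open>q\<close> is negative, and together they contribute
  \<open>\<alpha>\<^sup>d(n - |R(T)|)\<close>. So \<open>a\<^sub>i\<close> is the number of \<open>T\<close> with \<open>|R(T)| = i\<close>.
  Exactly one \<open>T\<close> contains \<open>q\<close>, hence \<open>a\<^sub>0 = 1\<close>. If \<open>|R(T)| \<ge> d\<close>, the remaining
  vertex of \<open>T\<close> would lie strictly between \<open>q\<close> and the face spanned by \<open>R(T)\<close>, but it is a
  vertex of \<open>P\<close>.
\<close>

subsection \<open>Simplices of the pointed triangulation\<close>

text \<open>The guard of the recursion: outside it both kinds of polytope numbers take the default
  value 0. It passes to nonempty faces, which is what inductions over faces need.\<close>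

definition admissible :: "'a::euclidean_space \<Rightarrow> 'a set \<Rightarrow> bool" where
  "admissible c P \<longleftrightarrow> polytope P \<and> P \<noteq> {} \<and> generic_on c P"

lemma admissible_face: "admissible c P \<Longrightarrow> F \<in> nonempty_faces P \<Longrightarrow> admissible c F"
  using face_inherits unfolding admissible_def by blast

lemma apex_props:
  assumes "admissible c P"
  shows "apex c P extreme_point_of P" "apex c P \<in> P" "x \<in> P \<Longrightarrow> c \<bullet> apex c P \<le> c \<bullet> x"
  using theI'[OF apex_unique_exists[of P c]] assms
  unfolding apex_def admissible_def extreme_point_of_def by blast+

lemma nonempty_faces_trans:
  "G \<in> nonempty_faces F \<Longrightarrow> F \<in> nonempty_faces P \<Longrightarrow> G \<in> nonempty_faces P"
  unfolding nonempty_faces_def using face_of_trans by blast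

lemma nonempty_faces_Int:
  assumes "F \<in> nonempty_faces P" "G \<in> nonempty_faces P" "F \<inter> G \<noteq> {}"
  shows "F \<inter> G \<in> nonempty_faces F" "F \<inter> G \<in> nonempty_faces G"
proof -
  have "(F \<inter> G) face_of P" using assms(1,2) unfolding nonempty_faces_def by (simp add: face_of_Int)
  then have "(F \<inter> G) face_of F" "(F \<inter> G) face_of G"
    using assms(1,2) unfolding nonempty_faces_def
    by (metis (no_types, lifting) face_of_face inf_le1 inf_le2 mem_Collect_eq)+
  then show "F \<inter> G \<in> nonempty_faces F" "F \<inter> G \<in> nonempty_faces G"
    using assms(3) unfolding nonempty_faces_def by auto
qed

lemma nonempty_faces_subset: "F \<in> nonempty_faces P \<Longrightarrow> F \<subseteq> P"
  unfolding nonempty_faces_def using face_of_imp_subset by blast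

lemma nonempty_faces_self: "admissible c P \<Longrightarrow> P \<in> nonempty_faces P"
  unfolding nonempty_faces_def admissible_def by (auto simp: face_of_refl polytope_imp_convex)

lemma finite_nonempty_faces: "admissible c P \<Longrightarrow> finite (nonempty_faces P)"
  unfolding nonempty_faces_def admissible_def
  by (rule finite_subset[OF _ finite_polytope_faces]) auto

text \<open>The apex of \<open>P\<close> is still extreme in \<open>F\<close> and still minimises
  \<open>c\<close> there, and such a vertex is unique.\<close>

lemma apex_face:
  assumes "admissible c P" "F \<in> nonempty_faces P" "apex c P \<in> F"
  shows "apex c F = apex c P"
proof -
  have F: "admissible c F" using assms admissible_face by blast
  have "apex c P extreme_point_of F"
    using assms apex_props(1)[OF assms(1)] extreme_point_of_face unfolding nonempty_faces_def by blast
  moreover have "\<forall>x\<in>F. c \<bullet> apex c P \<le> c \<bullet> x"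
    using apex_props(3)[OF assms(1)] nonempty_faces_subset[OF assms(2)] by blast
  ultimately show ?thesis
    using the1_equality[OF apex_unique_exists[of F c]] F
    unfolding admissible_def apex_def by blast
qed

text \<open>Induction on dimension, which drops strictly from \<open>P\<close> to a proper nonempty
  face. It is the outer of the two inductions that define the polytope numbers.\<close>

lemma face_induct [consumes 1, case_names step]:
  assumes "admissible c P"
    and "\<And>P. admissible c P \<Longrightarrow> (\<And>F. F \<in> nonempty_faces P \<Longrightarrow> F \<noteq> P \<Longrightarrow> Q F) \<Longrightarrow> Q P"
  shows "Q P"
  using assms(1)
proof (induction "nat (aff_dim P)" arbitrary: P rule: less_induct)
  case less
  show ?case
  proof (rule assms(2)[OF less.prems])
    fix F assume F: "F \<in> nonempty_faces P" "F \<noteq> P"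
    then have "nat (aff_dim F) < nat (aff_dim P)"
      using face_dim_less less.prems unfolding admissible_def by blast
    then show "Q F"
      using less.hyps admissible_face less.prems F by blast
  qed
qed

text \<open>
  A simplex is represented by its vertex set. Reading a derivation from the conclusion upwards
  gives a chain of faces as in \<^const>\<open>pointed_triangulation\<close>; \<open>base\<close> drops the apex of a face,
  \<open>cone\<close> keeps it.
\<close>

inductive pointed_simplex :: "'a::euclidean_space \<Rightarrow> 'a set \<Rightarrow> 'a set \<Rightarrow> bool" for c where
  apex: "pointed_simplex c P {apex c P}"
| base: "\<lbrakk>F \<in> nonempty_faces P; apex c P \<notin> F; pointed_simplex c F S\<rbrakk> \<Longrightarrow> pointed_simplex c P S"
| cone: "\<lbrakk>F \<in> nonempty_faces P; apex c P \<notin> F; pointed_simplex c F S\<rbrakk> \<Longrightarrow>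
    pointed_simplex c P (insert (apex c P) S)"

text \<open>Coning keeps affine independence because a face satisfies
  \<open>F = affine hull F \<inter> P\<close>: an apex in \<open>P\<close> but outside
  \<open>F\<close> is also outside \<open>affine hull F\<close>.\<close>

lemma pointed_simplex_basic:
  assumes "pointed_simplex c P S" "admissible c P"
  shows "S \<subseteq> P \<and> S \<noteq> {} \<and> \<not> affine_dependent S"
  using assms
proof (induction rule: pointed_simplex.induct)
  case (apex P)
  then show ?case using apex_props by auto
next
  case (base F P S)
  then show ?case using admissible_face nonempty_faces_subset by blast
next
  case (cone F P S)
  have F: "admissible c F" using cone admissible_face by blast
  have "apex c P \<notin> affine hull F"
    using cone apex_props(2)[OF cone.prems] face_of_imp_eq_affine_Int[of P F]
    unfolding nonempty_faces_def admissible_def by (auto simp: polytope_imp_convex)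
  then have "apex c P \<notin> affine hull S"
    using cone.IH[OF F] hull_mono by blast
  then show ?case
    using cone.IH[OF F] affine_independent_insert apex_props(2)[OF cone.prems]
      nonempty_faces_subset[OF cone.hyps(1)] by auto
qed

lemma pointed_simplex_finite: "pointed_simplex c P S \<Longrightarrow> finite S"
  by (induction rule: pointed_simplex.induct) auto

text \<open>Serves two purposes: only finitely many simplices exist, and the vertex singled out in
  \<open>card_negative_vertices\<close> cannot lie inside a segment of \<open>P\<close>.\<close>

lemma pointed_simplex_extreme_points:
  assumes "pointed_simplex c P S" "admissible c P" "v \<in> S"
  shows "v extreme_point_of P"
proof -
  have "S \<subseteq> {v. v extreme_point_of P}"
    using assms(1,2)
  proof (induction rule: pointed_simplex.induct)
    case (apex P)
    then show ?case using apex_props by auto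
  next
    case (base F P S)
    then show ?case
      using admissible_face extreme_point_of_face unfolding nonempty_faces_def by blast
  next
    case (cone F P S)
    then have "S \<subseteq> {v. v extreme_point_of P}"
      using admissible_face extreme_point_of_face unfolding nonempty_faces_def by blast
    then show ?case using apex_props[OF cone.prems] by auto
  qed
  then show ?thesis using assms(3) by auto
qed

lemma finite_pointed_simplexes:
  assumes "admissible c P"
  shows "finite {S. pointed_simplex c P S}"
proof (rule finite_subset)
  show "{S. pointed_simplex c P S} \<subseteq> Pow {v. v extreme_point_of P}"
    using pointed_simplex_extreme_points assms by blast
  show "finite (Pow {v. v extreme_point_of P})"
    using assms finite_polyhedron_extreme_points polytope_imp_polyhedron
    unfolding admissible_def by blast
qed

text \<open>If \<open>F\<close> contains the apex of \<open>P\<close>, both have the same apex, and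
  the rule that produced \<open>S\<close> in \<open>F\<close> applies in \<open>P\<close> with the
  same smaller face.\<close>

lemma pointed_simplex_mono:
  assumes "admissible c P" "F \<in> nonempty_faces P" "pointed_simplex c F S"
  shows "pointed_simplex c P S"
proof (cases "apex c P \<in> F")
  case False
  then show ?thesis using assms pointed_simplex.base by blast
next
  case True
  then have v: "apex c F = apex c P" using assms apex_face by blast
  from assms(3) show ?thesis
    by cases (metis v pointed_simplex.intros nonempty_faces_trans assms(2))+
qed

text \<open>The triangulation of \<open>P\<close> induces that of each face. In the induction the
  face \<open>G\<close> carrying the base is replaced by \<open>F \<inter> G\<close>, a face of
  both; in the cone case \<open>F\<close> contains the apex of \<open>P\<close> and so shares
  it.\<close>

lemma pointed_simplex_restrict:
  assumes "pointed_simplex c P S" "admissible c P" "F \<in> nonempty_faces P" "S \<subseteq> F"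
  shows "pointed_simplex c F S"
  using assms
proof (induction arbitrary: F rule: pointed_simplex.induct)
  case (apex P)
  then have "apex c F = apex c P" using apex_face by blast
  then show ?case using pointed_simplex.apex[of c F] by simp
next
  case (base G P S)
  have G: "admissible c G" using base admissible_face by blast
  have "S \<subseteq> F \<inter> G" "S \<noteq> {}" using base pointed_simplex_basic[OF base.hyps(3) G] by auto
  then have "F \<inter> G \<in> nonempty_faces F" "F \<inter> G \<in> nonempty_faces G"
    using nonempty_faces_Int[OF base.prems(2) base.hyps(1)] by auto
  moreover have "admissible c F" using base admissible_face by blast
  ultimately show ?case
    using pointed_simplex_mono base.IH[OF G] \<open>S \<subseteq> F \<inter> G\<close> by blast
next
  case (cone G P S)
  have G: "admissible c G" using cone admissible_face by blast
  have "S \<subseteq> F \<inter> G" "S \<noteq> {}" using cone pointed_simplex_basic[OF cone.hyps(3) G] by auto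
  then have *: "F \<inter> G \<in> nonempty_faces F" "F \<inter> G \<in> nonempty_faces G"
    using nonempty_faces_Int[OF cone.prems(2) cone.hyps(1)] by auto
  have v: "apex c F = apex c P" using apex_face cone by auto
  have "pointed_simplex c (F \<inter> G) S" using cone.IH[OF G *(2)] \<open>S \<subseteq> F \<inter> G\<close> by blast
  then show ?case
    using pointed_simplex.cone[OF *(1), of c S] v cone.hyps by auto
qed

lemma pointed_simplex_subset:
  assumes "pointed_simplex c P S" "T \<subseteq> S" "T \<noteq> {}"
  shows "pointed_simplex c P T"
  using assms
proof (induction arbitrary: T rule: pointed_simplex.induct)
  case (apex P)
  then have "T = {apex c P}" by auto
  then show ?case by (simp add: pointed_simplex.apex)
next
  case (base F P S)
  show ?case
    by (rule pointed_simplex.base[OF base.hyps(1,2) base.IH[OF base.prems]])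
next
  case (cone F P S)
  show ?case
  proof (cases "T - {apex c P} = {}")
    case True
    then have "T = {apex c P}" using cone by auto
    then show ?thesis by (simp add: pointed_simplex.apex)
  next
    case False
    then have *: "pointed_simplex c F (T - {apex c P})"
      using cone.IH[of "T - {apex c P}"] cone.prems(1) by auto
    show ?thesis
    proof (cases "apex c P \<in> T")
      case True
      then show ?thesis using pointed_simplex.cone[OF cone.hyps(1,2) *] by (simp add: insert_absorb)
    next
      case False
      then show ?thesis using pointed_simplex.base[OF cone.hyps(1,2) *] by simp
    qed
  qed
qed

section \<open>Sorting simplices by the face to which they are interior\<close>

text \<open>These are the simplices whose relative interior lies in that of \<open>P\<close>. They
  are to \<open>interior_polytope_number\<close> what all simplices are to
  \<open>polytope_number\<close>.\<close>

definition interior_pointed_simplex :: "'a::euclidean_space \<Rightarrow> 'a set \<Rightarrow> 'a set \<Rightarrow> bool" where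
  "interior_pointed_simplex c P S \<longleftrightarrow>
     pointed_simplex c P S \<and> (\<forall>F\<in>nonempty_faces P. S \<subseteq> F \<longrightarrow> F = P)"

text \<open>The smallest face containing \<open>S\<close> works: a face of it that contains
  \<open>S\<close> is one of the faces intersected.\<close>

lemma interior_pointed_simplex_exists:
  assumes "admissible c P" "pointed_simplex c P S"
  obtains F where "F \<in> nonempty_faces P" "interior_pointed_simplex c F S"
proof -
  define F where "F = \<Inter>{F \<in> nonempty_faces P. S \<subseteq> F}"
  have S: "S \<subseteq> P" "S \<noteq> {}" using pointed_simplex_basic assms by blast+
  have P: "P \<in> {F \<in> nonempty_faces P. S \<subseteq> F}" using nonempty_faces_self assms S by blast
  have SF: "S \<subseteq> F" unfolding F_def by blast
  have "F face_of P" unfolding F_def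
    by (rule face_of_Inter) (use P in \<open>auto simp: nonempty_faces_def\<close>)
  then have F: "F \<in> nonempty_faces P" using SF S unfolding nonempty_faces_def by auto
  moreover have "interior_pointed_simplex c F S"
    unfolding interior_pointed_simplex_def
  proof (intro conjI ballI impI)
    show "pointed_simplex c F S" using pointed_simplex_restrict assms F SF by blast
    fix G assume G: "G \<in> nonempty_faces F" "S \<subseteq> G"
    then have "F \<subseteq> G" using nonempty_faces_trans[OF G(1) F] unfolding F_def by blast
    then show "G = F" using nonempty_faces_subset G by blast
  qed
  ultimately show ?thesis using that by blast
qed

text \<open>\<open>F \<inter> G\<close> is a nonempty face of both that contains \<open>S\<close>,
  so interiority makes it equal to each.\<close>

lemma interior_pointed_simplex_unique:
  assumes "admissible c P" "F \<in> nonempty_faces P" "G \<in> nonempty_faces P"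
    "interior_pointed_simplex c F S" "interior_pointed_simplex c G S"
  shows "F = G"
proof -
  have "S \<subseteq> F" "S \<subseteq> G" "S \<noteq> {}"
    using assms pointed_simplex_basic admissible_face unfolding interior_pointed_simplex_def by metis+
  then have "F \<inter> G \<noteq> {}" "S \<subseteq> F \<inter> G" by auto
  then show ?thesis
    using nonempty_faces_Int[OF assms(2,3)] assms(4,5) unfolding interior_pointed_simplex_def by blast
qed

text \<open>A family of faces closed under passing to subfaces has its simplices partitioned by the
  face to which they are interior. It is applied to the faces missing the apex and to all nonempty
  faces.\<close>

lemma sum_pointed_simplexes_faces:
  fixes f :: "'a::euclidean_space set \<Rightarrow> int"
  assumes P: "admissible c P" and U: "\<F> \<subseteq> nonempty_faces P"
    and down: "\<And>F G. F \<in> \<F> \<Longrightarrow> G \<in> nonempty_faces F \<Longrightarrow> G \<in> \<F>"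
  shows "(\<Sum>S | \<exists>F\<in>\<F>. pointed_simplex c F S. f S) =
    (\<Sum>F\<in>\<F>. \<Sum>S | interior_pointed_simplex c F S. f S)"
proof -
  have ex: "\<exists>G\<in>\<F>. interior_pointed_simplex c G S" if F: "F \<in> \<F>" and S: "pointed_simplex c F S" for F S
  proof -
    have "admissible c F" using F U P admissible_face by blast
    then obtain G where "G \<in> nonempty_faces F" "interior_pointed_simplex c G S"
      using interior_pointed_simplex_exists S by blast
    then show ?thesis using down[OF F] by blast
  qed
  have "{S. \<exists>F\<in>\<F>. pointed_simplex c F S} = (\<Union>F\<in>\<F>. {S. interior_pointed_simplex c F S})"
    using ex by (auto simp: interior_pointed_simplex_def)
  moreover have "finite \<F>" using U finite_nonempty_faces[OF P] finite_subset by blast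
  moreover have "finite {S. interior_pointed_simplex c F S}" if "F \<in> \<F>" for F
    by (rule finite_subset[OF _ finite_pointed_simplexes[of c F]])
      (use that U P admissible_face in \<open>auto simp: interior_pointed_simplex_def\<close>)
  moreover have "{S. interior_pointed_simplex c F S} \<inter> {S. interior_pointed_simplex c G S} = {}"
    if "F \<in> \<F>" "G \<in> \<F>" "F \<noteq> G" for F G
    using interior_pointed_simplex_unique[OF P] that U by blast
  ultimately show ?thesis
    by (simp add: sum.UNION_disjoint)
qed

text \<open>The nonempty simplices of the link of the apex; the triangulation is the cone over
  them.\<close>

definition base_simplexes :: "'a::euclidean_space \<Rightarrow> 'a set \<Rightarrow> 'a set set" where
  "base_simplexes c P = {S. \<exists>F\<in>{F \<in> nonempty_faces P. apex c P \<notin> F}. pointed_simplex c F S}"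

lemma pointed_simplexes_eq:
  "{S. pointed_simplex c P S} =
     insert {apex c P} (base_simplexes c P \<union> insert (apex c P) ` base_simplexes c P)"
  (is "?L = ?R")
proof
  show "?L \<subseteq> ?R"
  proof
    fix S assume "S \<in> ?L"
    then have "pointed_simplex c P S" by simp
    then show "S \<in> ?R"
      by cases (auto simp: base_simplexes_def)
  qed
  show "?R \<subseteq> ?L"
    unfolding base_simplexes_def by (auto intro: pointed_simplex.intros)
qed

lemma base_simplexes_props:
  assumes "admissible c P" "S \<in> base_simplexes c P"
  shows "apex c P \<notin> S" "S \<noteq> {}" "finite S"
proof -
  obtain F where F: "F \<in> nonempty_faces P" "apex c P \<notin> F" "pointed_simplex c F S"
    using assms unfolding base_simplexes_def by auto
  then have "S \<subseteq> F \<and> S \<noteq> {}" using pointed_simplex_basic admissible_face[OF assms(1)] by blast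
  then show "apex c P \<notin> S" "S \<noteq> {}" using F by auto
  show "finite S" using F pointed_simplex_finite by blast
qed

text \<open>The term \<open>f 1\<close> comes from the apex alone; a base simplex enters once by
  itself and once coned to the apex, with one more vertex.\<close>

lemma sum_pointed_simplexes:
  fixes f :: "nat \<Rightarrow> int"
  assumes P: "admissible c P"
  shows "(\<Sum>S | pointed_simplex c P S. f (card S)) =
    f 1 + (\<Sum>S\<in>base_simplexes c P. f (card S) + f (Suc (card S)))"
proof -
  let ?B = "base_simplexes c P" and ?v = "apex c P"
  have fin: "finite ?B"
    by (rule finite_subset[OF _ finite_pointed_simplexes[OF P]]) (subst pointed_simplexes_eq, auto)
  have inj: "inj_on (insert ?v) ?B"
    by (rule inj_onI) (metis base_simplexes_props(1)[OF P] insert_ident)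
  have "(\<Sum>S | pointed_simplex c P S. f (card S)) =
      f (card {?v}) + (\<Sum>S\<in>?B \<union> insert ?v ` ?B. f (card S))"
    unfolding pointed_simplexes_eq
    by (rule sum.insert) (use fin base_simplexes_props[OF P] in \<open>force+\<close>)
  also have "(\<Sum>S\<in>?B \<union> insert ?v ` ?B. f (card S)) =
      (\<Sum>S\<in>?B. f (card S)) + (\<Sum>S\<in>insert ?v ` ?B. f (card S))"
    by (rule sum.union_disjoint) (use fin base_simplexes_props[OF P] in auto)
  also have "(\<Sum>S\<in>insert ?v ` ?B. f (card S)) = (\<Sum>S\<in>?B. f (Suc (card S)))"
    by (subst sum.reindex[OF inj]) (auto intro!: sum.cong simp: base_simplexes_props[OF P])
  finally show ?thesis by (simp add: sum.distrib)
qed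

subsection \<open>Polytope numbers as sums over simplices\<close>

text \<open>The number of compositions of \<open>N + 1\<close> into \<open>k\<close> positive parts.\<close>

definition compositions :: "nat \<Rightarrow> nat \<Rightarrow> nat" where
  "compositions N k = (case k of 0 \<Rightarrow> 0 | Suc j \<Rightarrow> N choose j)"

text \<open>Pascal's rule: the last part of a composition is either 1 and can be deleted, or larger
  and can be lowered by 1.\<close>

lemma compositions_Suc: "compositions (Suc N) (Suc k) = compositions N k + compositions N (Suc k)"
  by (cases k) (auto simp: compositions_def)

text \<open>A free vertex \<open>v\<close> splits the interval of sets in two, according to whether
  \<open>v\<close> is left out or moved into \<open>R\<close>. Pascal's rule merges the two values
  into one with both arguments raised by 1.\<close>

lemma sum_compositions_interval:
  assumes "finite D" "finite R" "R \<inter> D = {}"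
  shows "(\<Sum>S | R \<subseteq> S \<and> S \<subseteq> R \<union> D. compositions N (card S)) =
    compositions (N + card D) (card R + card D)"
  using assms
proof (induction D arbitrary: R rule: finite_induct)
  case empty
  have "{S. R \<subseteq> S \<and> S \<subseteq> R \<union> {}} = {R}" by auto
  then show ?case by simp
next
  case (insert v D)
  let ?I = "\<lambda>R. {S. R \<subseteq> S \<and> S \<subseteq> R \<union> D}"
  have split: "{S. R \<subseteq> S \<and> S \<subseteq> R \<union> insert v D} = ?I R \<union> ?I (insert v R)"
    by auto
  have fin: "finite (?I R)" if "finite R" for R
    by (rule finite_subset[of _ "Pow (R \<union> D)"]) (use that insert.hyps in auto)
  have "?I R \<inter> ?I (insert v R) = {}"
    using insert by auto
  then have "(\<Sum>S | R \<subseteq> S \<and> S \<subseteq> R \<union> insert v D. compositions N (card S)) =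
      (\<Sum>S\<in>?I R. compositions N (card S)) + (\<Sum>S\<in>?I (insert v R). compositions N (card S))"
    unfolding split by (intro sum.union_disjoint fin) (use insert in auto)
  also have "\<dots> = compositions (N + card D) (card R + card D) +
      compositions (N + card D) (Suc (card R + card D))"
    using insert.IH[of R] insert.IH[of "insert v R"] insert by auto
  also have "\<dots> = compositions (N + card (insert v D)) (card R + card (insert v D))"
    using insert by (simp add: compositions_Suc)
  finally show ?case .
qed

text \<open>Both sides are binomials with lower index \<open>d\<close>. For \<open>n \<le> r\<close>
  the upper index on the left is below \<open>d\<close>, which matches the cutoff to 0 in
  \<open>simplex_number\<close>.\<close>

lemma compositions_simplex_number:
  assumes "2 \<le> n" "r \<le> Suc d"
  shows "int (compositions (n - 2 + (Suc d - r)) (Suc d)) = simplex_number d (int n - int r)"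
proof (cases "n \<le> r")
  case True
  then show ?thesis using assms by (auto simp: compositions_def simplex_number_def)
next
  case False
  then have "nat (int n - int r + int d - 1) = n - 2 + (Suc d - r)"
    using assms by auto
  then show ?thesis using False by (simp add: compositions_def simplex_number_def)
qed

section \<open>From the recursion to sums over simplices\<close>

text \<open>In dimension 0 both face sums of the recursion are empty, so for
  \<open>n \<ge> 2\<close> the recursion equations also hold for points.\<close>

lemma point_faces:
  assumes "admissible c P" "aff_dim P = 0"
  shows "nonempty_faces P = {P}" "{F \<in> nonempty_faces P. apex c P \<notin> F} = {}"
proof -
  obtain v where v: "P = {v}" using assms(2) aff_dim_eq_0 by blast
  show *: "nonempty_faces P = {P}"
    using nonempty_faces_self[OF assms(1)] nonempty_faces_subset[of _ P]
    unfolding v nonempty_faces_def by auto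
  show "{F \<in> nonempty_faces P. apex c P \<notin> F} = {}"
    using apex_props(2)[OF assms(1)] unfolding * by auto
qed

lemma polytope_number_1: "admissible c P \<Longrightarrow> polytope_number c P 1 = 1"
  by (subst polytope_number.simps) (auto simp: admissible_def)

lemma polytope_number_rec:
  assumes "admissible c P" "2 \<le> n"
  shows "polytope_number c P n = polytope_number c P (n - 1) +
    (\<Sum>F\<in>{F \<in> nonempty_faces P. apex c P \<notin> F}. interior_polytope_number c F n)"
proof (cases "aff_dim P = 0")
  case True
  then have "polytope_number c P n = 1" "polytope_number c P (n - 1) = 1"
    using assms by (subst polytope_number.simps; simp add: admissible_def)+
  then show ?thesis unfolding point_faces(2)[OF assms(1) True] by simp
next
  case False
  then show ?thesis
    using assms by (subst polytope_number.simps) (simp add: admissible_def)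
qed

lemma interior_polytope_number_rec:
  assumes "admissible c P" "2 \<le> n"
  shows "interior_polytope_number c P n = polytope_number c P n -
    (\<Sum>F\<in>nonempty_faces P - {P}. interior_polytope_number c F n)"
proof (cases "aff_dim P = 0")
  case True
  then have "polytope_number c P n = 1" "interior_polytope_number c P n = 1"
    using assms
    by (subst polytope_number.simps interior_polytope_number.simps; simp add: admissible_def)+
  then show ?thesis unfolding point_faces(1)[OF assms(1) True] by simp
next
  case False
  then show ?thesis
    using assms by (subst interior_polytope_number.simps) (simp add: admissible_def)
qed

text \<open>Both kinds of numbers are treated together, since those of \<open>P\<close> depend on
  the interior numbers of its proper faces.\<close>

lemma polytope_numbers_eq_sum:
  assumes "admissible c P"
  shows "\<forall>n\<ge>2. polytope_number c P n =
      (\<Sum>S | pointed_simplex c P S. int (compositions (n - 2) (card S))) \<and>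
    interior_polytope_number c P n =
      (\<Sum>S | interior_pointed_simplex c P S. int (compositions (n - 2) (card S)))"
  using assms
proof (induction rule: face_induct)
  case (step P)
  let ?w = "\<lambda>n S. int (compositions (n - 2) (card S))"
  let ?A = "{F \<in> nonempty_faces P. apex c P \<notin> F}"
  have base: "(\<Sum>F\<in>?A. interior_polytope_number c F n) = (\<Sum>S\<in>base_simplexes c P. ?w n S)"
    if "2 \<le> n" for n
  proof -
    have "(\<Sum>F\<in>?A. interior_polytope_number c F n) =
        (\<Sum>F\<in>?A. \<Sum>S | interior_pointed_simplex c F S. ?w n S)"
      using step that apex_props(2) by (intro sum.cong) auto
    also have "\<dots> = (\<Sum>S\<in>base_simplexes c P. ?w n S)"
      unfolding base_simplexes_def
      by (rule sum_pointed_simplexes_faces[OF step.hyps, symmetric])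
        (use nonempty_faces_trans nonempty_faces_subset in blast)+
    finally show ?thesis .
  qed
  have sum_P: "(\<Sum>S | pointed_simplex c P S. ?w n S) =
      1 + (\<Sum>S\<in>base_simplexes c P. ?w n S + int (compositions (n - 2) (Suc (card S))))" for n
    using sum_pointed_simplexes[OF step.hyps, of "\<lambda>k. int (compositions (n - 2) k)"]
    by (simp add: compositions_def)
  have rec: "polytope_number c P n = polytope_number c P (n - 1) + (\<Sum>S\<in>base_simplexes c P. ?w n S)"
    if "2 \<le> n" for n
    using polytope_number_rec[OF step.hyps that] base[OF that] by simp
  have num: "polytope_number c P n = (\<Sum>S | pointed_simplex c P S. ?w n S)" if "2 \<le> n" for n
    using that
  proof (induction n rule: dec_induct)
    case base
    \<comment> \<open>At \<open>n = 2\<close> all cones over base simplices have weight 0, and the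
      apex accounts for the value 1 at \<open>n = 1\<close>.\<close>
    have "compositions 0 (Suc (card S)) = 0" if "S \<in> base_simplexes c P" for S
      using base_simplexes_props[OF step.hyps that] by (simp add: compositions_def card_gt_0_iff)
    then show ?case
      using rec[of 2] polytope_number_1[OF step.hyps] unfolding sum_P by simp
  next
    case (step n)
    \<comment> \<open>By Pascal's rule a cone weighs at \<open>Suc n\<close> as much as the cone and
      its base together at \<open>n\<close>. Hence the whole sum grows by the base weights at
      \<open>Suc n\<close>, exactly as in \<open>rec\<close>.\<close>
    have eq: "Suc n - 2 = Suc (n - 2)" using step.hyps by simp
    show ?case
      using rec[of "Suc n"] step(1,3) sum_P[of n] sum_P[of "Suc n", unfolded eq compositions_Suc]
      unfolding eq by (simp add: sum.distrib)
  qed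
  have faces: "{S. \<exists>F\<in>nonempty_faces P. pointed_simplex c F S} = {S. pointed_simplex c P S}"
    using pointed_simplex_mono[OF step.hyps] nonempty_faces_self[OF step.hyps] by blast
  \<comment> \<open>Sorting the simplices by faces and splitting off those interior to
    \<open>P\<close> reproduces the recursion for interior numbers.\<close>
  have int: "interior_polytope_number c P n = (\<Sum>S | interior_pointed_simplex c P S. ?w n S)"
    if "2 \<le> n" for n
  proof -
    have "(\<Sum>S | pointed_simplex c P S. ?w n S) =
        (\<Sum>F\<in>nonempty_faces P. \<Sum>S | interior_pointed_simplex c F S. ?w n S)"
      unfolding faces[symmetric]
      by (rule sum_pointed_simplexes_faces[OF step.hyps]) (use nonempty_faces_trans in blast)+
    also have "\<dots> = (\<Sum>S | interior_pointed_simplex c P S. ?w n S) +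
        (\<Sum>F\<in>nonempty_faces P - {P}. \<Sum>S | interior_pointed_simplex c F S. ?w n S)"
      by (rule sum.remove[OF finite_nonempty_faces[OF step.hyps] nonempty_faces_self[OF step.hyps]])
    also have "(\<Sum>F\<in>nonempty_faces P - {P}. \<Sum>S | interior_pointed_simplex c F S. ?w n S) =
        (\<Sum>F\<in>nonempty_faces P - {P}. interior_polytope_number c F n)"
      using step.IH that by (intro sum.cong) auto
    finally show ?thesis
      using interior_polytope_number_rec[OF step.hyps that] num[OF that] by simp
  qed
  show ?case using num int by blast
qed

subsection \<open>Every point lies in a unique open simplex\<close>

lemma affine_independent_coordinates_unique:
  fixes S :: "'a::real_vector set"
  assumes "finite S" "\<not> affine_dependent S" "sum u S = sum w S"
    "(\<Sum>v\<in>S. u v *\<^sub>R v) = (\<Sum>v\<in>S. w v *\<^sub>R v)" "v \<in> S"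
  shows "u v = w v"
proof (rule ccontr)
  assume "u v \<noteq> w v"
  then have "\<exists>v\<in>S. u v - w v \<noteq> 0" using assms(5) by auto
  moreover have "(\<Sum>v\<in>S. u v - w v) = 0" "(\<Sum>v\<in>S. (u v - w v) *\<^sub>R v) = 0"
    using assms by (auto simp: sum_subtractf scaleR_left_diff_distrib)
  ultimately show False
    using assms(1,2) affine_dependent_explicit_finite by blast
qed

text \<open>Coordinates with respect to an affinely independent set are unique, so any one
  representation decides membership.\<close>

lemma mem_rel_interior_simplex_iff:
  fixes S :: "'a::euclidean_space set"
  assumes "\<not> affine_dependent S" "sum u S = 1" "(\<Sum>v\<in>S. u v *\<^sub>R v) = x"
  shows "x \<in> rel_interior (convex hull S) \<longleftrightarrow> (\<forall>v\<in>S. 0 < u v)"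
proof
  assume "x \<in> rel_interior (convex hull S)"
  then obtain w where "\<forall>v\<in>S. 0 < w v" "sum w S = 1" "(\<Sum>v\<in>S. w v *\<^sub>R v) = x"
    unfolding rel_interior_convex_hull_explicit[OF assms(1)] by auto
  then show "\<forall>v\<in>S. 0 < u v"
    using affine_independent_coordinates_unique[of S u w] assms aff_independent_finite[OF assms(1)] by simp
next
  assume "\<forall>v\<in>S. 0 < u v"
  then show "x \<in> rel_interior (convex hull S)"
    unfolding rel_interior_convex_hull_explicit[OF assms(1)] using assms by auto
qed

text \<open>Split off the coordinate \<open>1 - t\<close> of \<open>v\<close> and divide the others
  by their sum \<open>t\<close> to get \<open>y\<close>; the converse multiplies the coordinates of
  \<open>y\<close> by \<open>t\<close>.\<close>

lemma rel_interior_simplex_cone: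
  fixes S :: "'a::euclidean_space set"
  assumes "\<not> affine_dependent (insert v S)" "v \<notin> S" "S \<noteq> {}"
  shows "x \<in> rel_interior (convex hull (insert v S)) \<longleftrightarrow>
    (\<exists>y\<in>rel_interior (convex hull S). x \<in> open_segment v y)"
proof -
  have S: "\<not> affine_dependent S" "finite S"
    using assms(1) affine_dependent_subset[of S "insert v S"] aff_independent_finite by auto
  show ?thesis
  proof
    assume "x \<in> rel_interior (convex hull (insert v S))"
    then obtain u where u: "\<forall>w\<in>insert v S. 0 < u w" "sum u (insert v S) = 1"
        "(\<Sum>w\<in>insert v S. u w *\<^sub>R w) = x"
      unfolding rel_interior_convex_hull_explicit[OF assms(1)] by auto
    define t where "t = sum u S"
    have t: "0 < t" "t < 1" "u v = 1 - t"
      using u S assms unfolding t_def by (auto intro: sum_pos)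
    define y where "y = (\<Sum>w\<in>S. (u w / t) *\<^sub>R w)"
    have "y \<in> rel_interior (convex hull S)"
      unfolding rel_interior_convex_hull_explicit[OF S(1)] y_def
      using u t by (auto simp: sum_divide_distrib[symmetric] t_def[symmetric] intro!: exI[of _ "\<lambda>w. u w / t"])
    moreover have "v \<noteq> y"
    proof
      assume "v = y"
      then have "v \<in> affine hull S"
        using calculation rel_interior_subset convex_hull_subset_affine_hull by blast
      then show False using assms(1,2) unfolding affine_dependent_def by auto
    qed
    moreover have "x = (1 - t) *\<^sub>R v + t *\<^sub>R y"
      using u(3) t S assms(2) unfolding y_def by (simp add: scaleR_sum_right)
    ultimately show "\<exists>y\<in>rel_interior (convex hull S). x \<in> open_segment v y"
      using t in_segment(2) by blast
  next
    assume "\<exists>y\<in>rel_interior (convex hull S). x \<in> open_segment v y"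
    then obtain y u t where u: "\<forall>w\<in>S. 0 < u w" "sum u S = 1" "(\<Sum>w\<in>S. u w *\<^sub>R w) = y"
      and t: "0 < t" "t < 1" "x = (1 - t) *\<^sub>R v + t *\<^sub>R y"
      unfolding rel_interior_convex_hull_explicit[OF S(1)] in_segment by auto
    let ?w = "\<lambda>w. if w = v then 1 - t else t * u w"
    have *: "sum ?w S = t" "(\<Sum>w\<in>S. ?w w *\<^sub>R w) = t *\<^sub>R y"
    proof -
      have "sum ?w S = (\<Sum>w\<in>S. t * u w)" using assms(2) by (intro sum.cong) auto
      then show "sum ?w S = t" using u(2) by (simp add: sum_distrib_left[symmetric])
      have "(\<Sum>w\<in>S. ?w w *\<^sub>R w) = (\<Sum>w\<in>S. t *\<^sub>R (u w *\<^sub>R w))"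
        using assms(2) by (intro sum.cong) auto
      then show "(\<Sum>w\<in>S. ?w w *\<^sub>R w) = t *\<^sub>R y"
        by (simp only: scaleR_sum_right[symmetric] u(3))
    qed
    have "sum ?w (insert v S) = 1" "(\<Sum>w\<in>insert v S. ?w w *\<^sub>R w) = x"
      using S(2) assms(2) t(3) by (simp_all add: *)
    then show "x \<in> rel_interior (convex hull (insert v S))"
      by (subst mem_rel_interior_simplex_iff[OF assms(1)]) (use t u in auto)
  qed
qed

text \<open>
  The ray from the apex through \<open>x\<close> leaves \<open>P\<close> at \<open>y\<close>; the smallest face through \<open>y\<close> misses the
  apex, as otherwise the ray could be prolonged inside that face.
\<close>

lemma ray_hits_face:
  assumes P: "admissible c P" and x: "x \<in> P" "x \<noteq> apex c P"
  obtains F y where "F \<in> nonempty_faces P" "apex c P \<notin> F" "y \<in> F"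
    "x = y \<or> x \<in> open_segment (apex c P) y"
proof -
  let ?v = "apex c P" and ?L = "affine hull {apex c P, x}"
  \<comment> \<open>\<open>?f\<close> measures progress along the line from the apex towards
    \<open>x\<close>; its maximum on the compact slice of \<open>P\<close> is the exit
    point.\<close>
  let ?f = "\<lambda>y. (x - ?v) \<bullet> (y - ?v)"
  have v: "?v \<in> P" using apex_props(2)[OF P] .
  have conv: "compact P" "convex P" "polyhedron P"
    using P unfolding admissible_def
    by (auto simp: polytope_imp_compact polytope_imp_convex polytope_imp_polyhedron)
  have "compact (P \<inter> ?L)" "P \<inter> ?L \<noteq> {}"
    using conv x hull_subset[of "{?v, x}" affine] by (auto intro: compact_Int_closed)
  moreover have "continuous_on (P \<inter> ?L) ?f" by (intro continuous_intros)
  ultimately obtain y where y: "y \<in> P" "y \<in> ?L" and max: "\<And>z. z \<in> P \<Longrightarrow> z \<in> ?L \<Longrightarrow> ?f z \<le> ?f y"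
    using continuous_attains_sup[of "P \<inter> ?L" ?f] by blast
  obtain t where t: "y = ?v + t *\<^sub>R (x - ?v)"
    using y(2) unfolding affine_hull_2_alt by auto
  have pos: "0 < (x - ?v) \<bullet> (x - ?v)" using x(2) by simp
  have "?f x \<le> ?f y" using max[OF x(1)] hull_subset[of "{?v, x}" affine] by auto
  then have "(x - ?v) \<bullet> (x - ?v) * 1 \<le> (x - ?v) \<bullet> (x - ?v) * t"
    unfolding t by (simp add: mult.commute)
  then have t1: "1 \<le> t" using pos mult_le_cancel_left_pos by blast
  define F where "F = \<Inter>{F. F face_of P \<and> y \<in> F}"
  have PP: "P \<in> {F. F face_of P \<and> y \<in> F}" using y conv by (auto simp: face_of_refl)
  have yF: "y \<in> F" unfolding F_def by auto
  have F: "F face_of P" unfolding F_def by (rule face_of_Inter) (use PP in auto)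
  \<comment> \<open>Otherwise a facet of \<open>F\<close> would be a smaller face through
    \<open>y\<close>.\<close>
  have "y \<in> rel_interior F"
  proof (rule ccontr)
    assume "y \<notin> rel_interior F"
    then have "y \<in> rel_frontier F" using yF closure_subset unfolding rel_frontier_def by blast
    moreover have "polyhedron F" using F conv face_of_polyhedron_polyhedron by blast
    ultimately obtain G where G: "G facet_of F" "y \<in> G"
      using rel_frontier_of_polyhedron by blast
    then have "G face_of P" "G \<noteq> F"
      using F face_of_trans unfolding facet_of_def by (blast, auto)
    then have "F \<subseteq> G" using G unfolding F_def by auto
    then show False using G \<open>G \<noteq> F\<close> facet_of_imp_subset by blast
  qed
  have "?v \<notin> F"
  proof
    assume "?v \<in> F"
    then have "?v \<in> affine hull F" by (simp add: hull_inc)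
    moreover have "convex F" using F face_of_imp_convex by blast
    ultimately obtain m where m: "1 < m" "\<And>e. 1 < e \<Longrightarrow> e \<le> m \<Longrightarrow> (1 - e) *\<^sub>R ?v + e *\<^sub>R y \<in> F"
      using convex_rel_interior_if[OF _ \<open>y \<in> rel_interior F\<close>] by blast
    let ?z = "(1 - m) *\<^sub>R ?v + m *\<^sub>R y"
    have z: "?z = ?v + (m * t) *\<^sub>R (x - ?v)" unfolding t by (simp add: algebra_simps)
    have "?z \<in> P" using m F face_of_imp_subset by blast
    moreover have "?z \<in> ?L" unfolding z affine_hull_2_alt by auto
    ultimately have "?f ?z \<le> ?f y" using max by blast
    then have "(x - ?v) \<bullet> (x - ?v) * (m * t) \<le> (x - ?v) \<bullet> (x - ?v) * t"
      unfolding z unfolding t by (simp add: mult.commute mult.left_commute)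
    then have "m * t \<le> t" using pos mult_le_cancel_left_pos by blast
    then show False using m(1) t1 by simp
  qed
  moreover have "x = y \<or> x \<in> open_segment ?v y"
  proof (cases "t = 1")
    case True
    then show ?thesis using t by simp
  next
    case False
    have "x = (1 - 1/t) *\<^sub>R ?v + (1/t) *\<^sub>R y"
      unfolding t using t1 by (simp add: algebra_simps)
    moreover have "?v \<noteq> y" using \<open>?v \<notin> F\<close> yF by auto
    moreover have "0 < 1/t" "1/t < 1" using t1 False by auto
    ultimately show ?thesis unfolding in_segment by blast
  qed
  moreover have "F \<in> nonempty_faces P" using F yF unfolding nonempty_faces_def by auto
  ultimately show ?thesis using that yF by blast
qed

text \<open>If \<open>y\<close> and \<open>z\<close> differ, one of them lies strictly between
  \<open>v\<close> and the other, and a face through that point would have to contain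
  \<open>v\<close>.\<close>

lemma ray_hits_face_unique:
  fixes P :: "'a::euclidean_space set"
  assumes "F face_of P" "G face_of P" "v \<in> P" "v \<notin> F" "v \<notin> G" "y \<in> F" "z \<in> G"
    and xy: "x = y \<or> x \<in> open_segment v y" and xz: "x = z \<or> x \<in> open_segment v z"
  shows "y = z"
proof -
  have no: False if "H face_of P" "v \<notin> H" "a \<in> H" "a \<in> open_segment v b" "b \<in> P" for H a b
    using that assms(3) unfolding face_of_def by blast
  have P: "y \<in> P" "z \<in> P" using assms face_of_imp_subset by blast+
  show ?thesis
  proof (cases "x = y \<or> x = z")
    case True
    then show ?thesis
      using no[of F y z] no[of G z y] assms P by auto
  next
    case False
    then obtain s t where s: "0 < s" "s < 1" "x = (1 - s) *\<^sub>R v + s *\<^sub>R y"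
      and t: "0 < t" "t < 1" "x = (1 - t) *\<^sub>R v + t *\<^sub>R z"
      using xy xz unfolding in_segment by blast
    have eq: "s *\<^sub>R (y - v) = t *\<^sub>R (z - v)"
      using s(3) t(3) by (simp add: algebra_simps)
    \<comment> \<open>Of two points on a ray from \<open>v\<close>, the one with the larger
      multiplier is nearer to \<open>v\<close>.\<close>
    have seg: "b \<in> open_segment v a" if "0 < p" "p < q" "p *\<^sub>R (a - v) = q *\<^sub>R (b - v)" "v \<noteq> a"
      for p q :: real and a b
    proof -
      have "b - v = (1 / q) *\<^sub>R (q *\<^sub>R (b - v))" using that by simp
      also have "\<dots> = (p / q) *\<^sub>R (a - v)" unfolding that(3)[symmetric] by simp
      finally have "b = (1 - p/q) *\<^sub>R v + (p/q) *\<^sub>R a" by (simp add: algebra_simps)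
      moreover have "0 < p/q" "p/q < 1" using that by auto
      ultimately show ?thesis using that(4) unfolding in_segment by blast
    qed
    consider "s = t" | "s < t" | "t < s" by linarith
    then show ?thesis
    proof cases
      case 1
      then show ?thesis using eq s by simp
    next
      case 2
      then have "z \<in> open_segment v y" using seg[OF s(1) _ eq] assms by auto
      then show ?thesis using no[of G z y] assms P by auto
    next
      case 3
      then have "y \<in> open_segment v z" using seg[OF t(1) _ eq[symmetric]] assms by auto
      then show ?thesis using no[of F y z] assms P by auto
    qed
  qed
qed

section \<open>Covering and disjointness by projection from the apex\<close>

lemma pointed_simplex_cone_independent:
  assumes "admissible c P" "F \<in> nonempty_faces P" "apex c P \<notin> F" "pointed_simplex c F S"
  shows "\<not> affine_dependent (insert (apex c P) S)" "apex c P \<notin> S" "S \<noteq> {}"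
    "convex hull S \<subseteq> F"
proof -
  have S: "S \<subseteq> F \<and> S \<noteq> {}" using pointed_simplex_basic admissible_face assms by blast
  then show "apex c P \<notin> S" "S \<noteq> {}" using assms(3) by auto
  show "\<not> affine_dependent (insert (apex c P) S)"
    using pointed_simplex_basic[OF pointed_simplex.cone[OF assms(2-4)] assms(1)] by blast
  show "convex hull S \<subseteq> F"
    using S assms(2) by (intro hull_minimal) (auto simp: nonempty_faces_def face_of_imp_convex)
qed

text \<open>Project \<open>x\<close> from the apex to a point \<open>y\<close> of a face missing the
  apex. That face is proper, so \<open>y\<close> lies in one of its open simplices, and
  \<open>x\<close> lies in that simplex or in the cone over it.\<close>

lemma pointed_simplexes_cover:
  assumes "admissible c P"
  shows "\<forall>x\<in>P. \<exists>S. pointed_simplex c P S \<and> x \<in> rel_interior (convex hull S)"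
  using assms
proof (induction rule: face_induct)
  case (step P)
  show ?case
  proof
    fix x assume x: "x \<in> P"
    show "\<exists>S. pointed_simplex c P S \<and> x \<in> rel_interior (convex hull S)"
    proof (cases "x = apex c P")
      case True
      then show ?thesis using pointed_simplex.apex[of c P] by (intro exI[of _ "{x}"]) auto
    next
      case False
      obtain F y where F: "F \<in> nonempty_faces P" "apex c P \<notin> F" "y \<in> F"
          "x = y \<or> x \<in> open_segment (apex c P) y"
        using ray_hits_face[OF step.hyps x False] .
      then have "F \<noteq> P" using apex_props(2)[OF step.hyps] by auto
      then obtain S where S: "pointed_simplex c F S" "y \<in> rel_interior (convex hull S)"
        using step.IH[OF F(1)] F(3) by blast
      note ind = pointed_simplex_cone_independent[OF step.hyps F(1,2) S(1)]
      show ?thesis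
        using F(4) S rel_interior_simplex_cone[OF ind(1-3)]
          pointed_simplex.base[OF F(1,2) S(1)] pointed_simplex.cone[OF F(1,2) S(1)] by blast
    qed
  qed
qed

text \<open>Brings the base and the cone rule into one form: \<open>y\<close> is the projection of
  \<open>x\<close> from the apex, equal to \<open>x\<close> in the base case.\<close>

lemma pointed_simplex_decompose:
  assumes "admissible c P" "pointed_simplex c P S" "x \<in> rel_interior (convex hull S)"
    "x \<noteq> apex c P"
  obtains F T y where "F \<in> nonempty_faces P" "apex c P \<notin> F" "pointed_simplex c F T"
    "y \<in> rel_interior (convex hull T)" "y \<in> F" "x = y \<or> x \<in> open_segment (apex c P) y"
    "S = (if x = y then T else insert (apex c P) T)"
  using assms(2)
proof cases
  case apex
  then show ?thesis using assms by auto
next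
  case (base F)
  have "x \<in> F"
    using pointed_simplex_cone_independent(4)[OF assms(1) base] assms(3) rel_interior_subset by blast
  then show ?thesis using that[OF base assms(3)] by simp
next
  case (cone F T)
  note ind = pointed_simplex_cone_independent[OF assms(1) cone(2-4)]
  obtain y where y: "y \<in> rel_interior (convex hull T)" "x \<in> open_segment (apex c P) y"
    using assms(3) rel_interior_simplex_cone[OF ind(1-3)] unfolding cone(1) by blast
  have "y \<in> F" using ind(4) y(1) rel_interior_subset by blast
  moreover have "x \<noteq> y" using y(2) unfolding open_segment_def by auto
  ultimately show ?thesis using that[OF cone(2-4) y(1)] y cone(1) by auto
qed

lemma pointed_simplex_apex:
  assumes "admissible c P" "pointed_simplex c P S" "apex c P \<in> rel_interior (convex hull S)"
  shows "S = {apex c P}"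
  using assms(2)
proof cases
  case (base F)
  then show ?thesis
    using pointed_simplex_cone_independent(4)[OF assms(1) base] assms(3) rel_interior_subset by blast
next
  case (cone F T)
  note ind = pointed_simplex_cone_independent[OF assms(1) cone(2-4)]
  show ?thesis
    using assms(3) rel_interior_simplex_cone[OF ind(1-3)] unfolding cone(1) open_segment_def by blast
qed

text \<open>Both simplices project \<open>x\<close> to the same point \<open>y\<close>, by
  \<open>ray_hits_face_unique\<close>. The two bases then lie in the common face \<open>H\<close>,
  where the induction hypothesis identifies them.\<close>

lemma pointed_simplexes_disjoint:
  assumes "admissible c P"
  shows "\<forall>x S T. pointed_simplex c P S \<and> pointed_simplex c P T \<and>
    x \<in> rel_interior (convex hull S) \<and> x \<in> rel_interior (convex hull T) \<longrightarrow> S = T"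
  using assms
proof (induction rule: face_induct)
  case (step P)
  show ?case
  proof (intro allI impI, elim conjE)
    fix x S T
    assume S: "pointed_simplex c P S" "x \<in> rel_interior (convex hull S)"
      and T: "pointed_simplex c P T" "x \<in> rel_interior (convex hull T)"
    show "S = T"
    proof (cases "x = apex c P")
      case True
      then show ?thesis using pointed_simplex_apex[OF step.hyps] S T by blast
    next
      case False
      obtain F A y where F: "F \<in> nonempty_faces P" "apex c P \<notin> F" "pointed_simplex c F A"
          "y \<in> rel_interior (convex hull A)" "y \<in> F" "x = y \<or> x \<in> open_segment (apex c P) y"
          "S = (if x = y then A else insert (apex c P) A)"
        using pointed_simplex_decompose[OF step.hyps S False] .
      obtain G B z where G: "G \<in> nonempty_faces P" "apex c P \<notin> G" "pointed_simplex c G B"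
          "z \<in> rel_interior (convex hull B)" "z \<in> G" "x = z \<or> x \<in> open_segment (apex c P) z"
          "T = (if x = z then B else insert (apex c P) B)"
        using pointed_simplex_decompose[OF step.hyps T False] .
      have "y = z"
        using ray_hits_face_unique[of F P G "apex c P" y z x] F G apex_props(2)[OF step.hyps]
        unfolding nonempty_faces_def by blast
      define H where "H = F \<inter> G"
      have "y \<in> H" using F G \<open>y = z\<close> unfolding H_def by auto
      have H: "H \<in> nonempty_faces F" "H \<in> nonempty_faces G"
        using nonempty_faces_Int[OF F(1) G(1)] \<open>y \<in> H\<close> unfolding H_def by auto
      have sub: "pointed_simplex c H C" if "E \<in> nonempty_faces P" "H \<in> nonempty_faces E" "apex c P \<notin> E"
        "pointed_simplex c E C" "y \<in> rel_interior (convex hull C)" for E C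
      proof -
        \<comment> \<open>A face that meets the relative interior of a convex subset contains that
          subset.\<close>
        have "convex hull C \<subseteq> H"
          using subset_of_face_of[of H E "convex hull C"] that \<open>y \<in> H\<close>
            pointed_simplex_cone_independent(4)[OF step.hyps that(1,3,4)]
          unfolding nonempty_faces_def by blast
        then have "C \<subseteq> H" using hull_subset[of C convex] by (rule order.trans[rotated])
        then show ?thesis
          by (rule pointed_simplex_restrict[OF that(4) admissible_face[OF step.hyps that(1)] that(2)])
      qed
      have "pointed_simplex c H A" "pointed_simplex c H B"
        using sub[OF F(1) H(1) F(2,3,4)] sub[OF G(1) H(2) G(2,3)] G(4) \<open>y = z\<close> by simp_all
      moreover have "H \<in> nonempty_faces P" "H \<noteq> P"
        using nonempty_faces_trans[OF H(1) F(1)] F(2) apex_props(2)[OF step.hyps] unfolding H_def by auto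
      ultimately have "A = B" using step.IH[of H] F(4) G(4) \<open>y = z\<close> by blast
      then show ?thesis using F(7) G(7) \<open>y = z\<close> by simp
    qed
  qed
qed

subsection \<open>Half-open decomposition\<close>

lemma affine_contains_line:
  fixes x y :: "'a::real_vector"
  assumes "affine A" "(1 - s) *\<^sub>R x + s *\<^sub>R y \<in> A" "(1 - t) *\<^sub>R x + t *\<^sub>R y \<in> A" "s \<noteq> t"
  shows "(1 - e) *\<^sub>R x + e *\<^sub>R y \<in> A"
proof -
  define k where "k = (e - s) / (t - s)"
  have "k * (t - s) = e - s" using assms(4) unfolding k_def by simp
  then have e: "e = (1 - k) * s + k * t" by (simp add: algebra_simps)
  have "(1 - k) *\<^sub>R ((1 - s) *\<^sub>R x + s *\<^sub>R y) + k *\<^sub>R ((1 - t) *\<^sub>R x + t *\<^sub>R y) \<in> A"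
    using assms(1-3) unfolding affine_alt by blast
  also have "(1 - k) *\<^sub>R ((1 - s) *\<^sub>R x + s *\<^sub>R y) + k *\<^sub>R ((1 - t) *\<^sub>R x + t *\<^sub>R y) =
      (1 - e) *\<^sub>R x + e *\<^sub>R y"
    unfolding e by (simp add: algebra_simps)
  finally show ?thesis .
qed

text \<open>Join a point \<open>p\<close> off the earlier subspaces to a point \<open>r\<close> off
  the new one. A subspace meeting this line twice contains both \<open>p\<close> and
  \<open>r\<close>, which is excluded, so only finitely many parameters in the unit interval are
  bad.\<close>

lemma convex_not_covered_by_affine:
  fixes S :: "'a::euclidean_space set"
  assumes "finite \<A>" "convex S" "S \<noteq> {}" "\<And>A. A \<in> \<A> \<Longrightarrow> affine A \<and> \<not> S \<subseteq> A"
  shows "\<exists>x\<in>S. \<forall>A\<in>\<A>. x \<notin> A"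
  using assms(1,4)
proof (induction \<A> rule: finite_induct)
  case empty
  then show ?case using assms(3) by auto
next
  case (insert B \<A>)
  then obtain p where p: "p \<in> S" "\<forall>A\<in>\<A>. p \<notin> A" by auto
  obtain r where r: "r \<in> S" "r \<notin> B" using insert.prems by blast
  define f where "f t = (1 - t) *\<^sub>R p + t *\<^sub>R r" for t
  have bad: "finite {t. f t \<in> A}" if A: "A \<in> insert B \<A>" for A
  proof (rule ccontr)
    assume inf: "infinite {t. f t \<in> A}"
    then obtain s where s: "f s \<in> A" by (metis Collect_empty_eq finite.emptyI)
    have "infinite ({t. f t \<in> A} - {s})" using inf by simp
    then obtain t where t: "f t \<in> A" "t \<noteq> s"
      by (metis (no_types, lifting) Diff_iff all_not_in_conv finite.emptyI insertCI mem_Collect_eq)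
    have line: "f e \<in> A" for e
      using affine_contains_line[of A s p r t e] insert.prems[OF A] s t unfolding f_def by blast
    have "p \<in> A" "r \<in> A" using line[of 0] line[of 1] unfolding f_def by auto
    then show False using p(2) r(2) A by auto
  qed
  have "finite (\<Union>A\<in>insert B \<A>. {t. f t \<in> A})"
    using bad insert.hyps(1) by (intro finite_UN_I) auto
  moreover have "infinite {0..1::real}" using infinite_Icc[of 0 "1::real"] by simp
  ultimately have "\<not> {0..1} \<subseteq> (\<Union>A\<in>insert B \<A>. {t. f t \<in> A})"
    using finite_subset by blast
  then obtain t where t: "t \<in> {0..1}" "\<forall>A\<in>insert B \<A>. f t \<notin> A" by blast
  moreover have "f t \<in> S"
    unfolding f_def using assms(2) p(1) r(1) t(1) by (auto simp: convex_alt)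
  ultimately show ?case by blast
qed

text \<open>General position that makes all barycentric coordinates of \<open>q\<close> nonzero in
  every full-dimensional simplex. The bound on \<open>card U\<close> keeps the avoided hulls of
  smaller dimension than \<open>P\<close>, so that such points exist.\<close>

definition generic_point :: "'a::euclidean_space \<Rightarrow> 'a set \<Rightarrow> 'a \<Rightarrow> bool" where
  "generic_point c P q \<longleftrightarrow> q \<in> P \<and>
     (\<forall>T U. pointed_simplex c P T \<longrightarrow> U \<subseteq> T \<longrightarrow> int (card U) \<le> aff_dim P \<longrightarrow> q \<notin> affine hull U)"

lemma generic_point_exists:
  assumes "admissible c P"
  shows "\<exists>q. generic_point c P q"
proof -
  let ?\<U> = "{U. (\<exists>T. pointed_simplex c P T \<and> U \<subseteq> T) \<and> int (card U) \<le> aff_dim P}"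
  have "?\<U> \<subseteq> \<Union> (Pow ` {T. pointed_simplex c P T})" by auto
  moreover have "finite (\<Union> (Pow ` {T. pointed_simplex c P T}))"
    using finite_pointed_simplexes[OF assms] pointed_simplex_finite by auto
  ultimately have fin: "finite ?\<U>" by (rule finite_subset)
  have "\<exists>q\<in>P. \<forall>A\<in>(hull) affine ` ?\<U>. q \<notin> A"
  proof (rule convex_not_covered_by_affine)
    fix A assume "A \<in> (hull) affine ` ?\<U>"
    then obtain U where U: "A = affine hull U" "U \<in> ?\<U>" by auto
    then have "finite U" using pointed_simplex_finite finite_subset by blast
    then have "aff_dim A < aff_dim P"
      using U aff_dim_le_card[of U] by simp
    then show "affine A \<and> \<not> P \<subseteq> A"
      using U(1) aff_dim_subset[of P A] by (auto simp: not_le[symmetric])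
  qed (use fin assms in \<open>auto simp: admissible_def polytope_imp_convex\<close>)
  then obtain x where "x \<in> P" "\<forall>U\<in>?\<U>. x \<notin> affine hull U" by auto
  then have "generic_point c P x" unfolding generic_point_def by blast
  then show ?thesis ..
qed

lemma generic_point_card:
  assumes "generic_point c P q" "pointed_simplex c P T" "U \<subseteq> T" "q \<in> affine hull U"
  shows "aff_dim P < int (card U)"
proof (rule ccontr)
  assume "\<not> aff_dim P < int (card U)"
  then have "int (card U) \<le> aff_dim P" by simp
  then have "q \<notin> affine hull U"
    using assms(1-3) unfolding generic_point_def by blast
  then show False using assms(4) by contradiction
qed

section \<open>Barycentric coordinates of the generic point\<close>

text \<open>For affinely independent \<open>T\<close> with \<open>q\<close> in its affine hull the
  choice is unique on \<open>T\<close>; values off \<open>T\<close> are arbitrary.\<close>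

definition barycentric :: "'a::euclidean_space \<Rightarrow> 'a set \<Rightarrow> 'a \<Rightarrow> real" where
  "barycentric q T = (SOME u. sum u T = 1 \<and> (\<Sum>v\<in>T. u v *\<^sub>R v) = q)"

lemma barycentric:
  assumes "finite T" "q \<in> affine hull T"
  shows "sum (barycentric q T) T = 1" "(\<Sum>v\<in>T. barycentric q T v *\<^sub>R v) = q"
proof -
  have "\<exists>u. sum u T = 1 \<and> (\<Sum>v\<in>T. u v *\<^sub>R v) = q"
    using assms unfolding affine_hull_finite[OF assms(1)] by auto
  from someI_ex[OF this] show "sum (barycentric q T) T = 1" "(\<Sum>v\<in>T. barycentric q T v *\<^sub>R v) = q"
    unfolding barycentric_def by blast+
qed

text \<open>The vertices opposite the facets of \<open>T\<close> that separate it from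
  \<open>q\<close>. Faces of \<open>T\<close> containing all of them are those that lie in none of
  these facets.\<close>

definition negative_vertices :: "'a::euclidean_space \<Rightarrow> 'a set \<Rightarrow> 'a set" where
  "negative_vertices q T = {v \<in> T. barycentric q T v < 0}"

definition full_simplexes :: "'a::euclidean_space \<Rightarrow> 'a set \<Rightarrow> 'a set set" where
  "full_simplexes c P = {T. pointed_simplex c P T \<and> int (card T) = aff_dim P + 1}"

lemma full_simplex_props:
  assumes "admissible c P" "T \<in> full_simplexes c P"
  shows "pointed_simplex c P T" "\<not> affine_dependent T" "finite T" "T \<subseteq> P"
    "affine hull T = affine hull P"
proof -
  show T: "pointed_simplex c P T" using assms unfolding full_simplexes_def by auto
  show "\<not> affine_dependent T" "finite T" "T \<subseteq> P"
    using pointed_simplex_basic[OF T assms(1)] pointed_simplex_finite[OF T] by auto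
  then have "aff_dim T = aff_dim P" "T \<subseteq> P"
    using aff_dim_affine_independent[of T] assms(2) unfolding full_simplexes_def by auto
  then show "affine hull T = affine hull P" using aff_dim_eq_full_gen by blast
qed

text \<open>A vanishing coordinate would put \<open>q\<close> into the affine hull of the remaining
  vertices, too few for a generic point.\<close>

lemma full_simplex_barycentric:
  assumes P: "admissible c P" and q: "generic_point c P q" and T: "T \<in> full_simplexes c P"
  shows "sum (barycentric q T) T = 1" "(\<Sum>v\<in>T. barycentric q T v *\<^sub>R v) = q"
    "\<And>v. v \<in> T \<Longrightarrow> barycentric q T v \<noteq> 0"
proof -
  note props = full_simplex_props[OF P T]
  have qT: "q \<in> affine hull T"
    unfolding props(5) using q by (simp add: generic_point_def hull_inc)
  show b: "sum (barycentric q T) T = 1" "(\<Sum>v\<in>T. barycentric q T v *\<^sub>R v) = q"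
    using barycentric[OF props(3) qT] by auto
  fix v assume v: "v \<in> T"
  show "barycentric q T v \<noteq> 0"
  proof
    assume 0: "barycentric q T v = 0"
    have "sum (barycentric q T) (T - {v}) = 1" "(\<Sum>w\<in>T - {v}. barycentric q T w *\<^sub>R w) = q"
      using b 0 v props(3) by (auto simp: sum_diff1)
    then have "q \<in> affine hull (T - {v})"
      using affine_hull_finite[of "T - {v}"] props(3) by auto
    then have "aff_dim P < int (card (T - {v}))"
      using generic_point_card[OF q props(1), of "T - {v}"] by auto
    then show False
      using T v props(3) card_gt_0_iff[of T] unfolding full_simplexes_def
      by (auto simp: card_Diff_singleton of_nat_diff)
  qed
qed

lemma rel_interior_simplex_segment:
  assumes P: "admissible c P" and q: "generic_point c P q" and T: "T \<in> full_simplexes c P"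
    and u: "sum u T = 1" "(\<Sum>v\<in>T. u v *\<^sub>R v) = x"
  shows "(1 - e) *\<^sub>R x + e *\<^sub>R q \<in> rel_interior (convex hull T) \<longleftrightarrow>
    (\<forall>v\<in>T. 0 < (1 - e) * u v + e * barycentric q T v)"
proof (rule mem_rel_interior_simplex_iff)
  note b = full_simplex_barycentric[OF P q T]
  show "\<not> affine_dependent T" using full_simplex_props[OF P T] by blast
  show "(\<Sum>v\<in>T. (1 - e) * u v + e * barycentric q T v) = 1"
    using b u by (simp add: sum.distrib sum_distrib_left[symmetric])
  show "(\<Sum>v\<in>T. ((1 - e) * u v + e * barycentric q T v) *\<^sub>R v) = (1 - e) *\<^sub>R x + e *\<^sub>R q"
  proof -
    have "(\<Sum>v\<in>T. ((1 - e) * u v + e * barycentric q T v) *\<^sub>R v) =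
        (\<Sum>v\<in>T. (1 - e) *\<^sub>R (u v *\<^sub>R v) + e *\<^sub>R (barycentric q T v *\<^sub>R v))"
      by (intro sum.cong) (auto simp: scaleR_left_distrib)
    then show ?thesis
      by (simp only: sum.distrib scaleR_sum_right[symmetric] u b)
  qed
qed

text \<open>At a vertex of \<open>S\<close> the coordinate is positive for \<open>e = 0\<close>,
  hence for small \<open>e\<close>. At any other vertex of \<open>T\<close> it is \<open>e\<close>
  times the coordinate of \<open>q\<close>, which is positive there.\<close>

lemma eventually_segment_in_simplex:
  assumes P: "admissible c P" and q: "generic_point c P q" and T: "T \<in> full_simplexes c P"
    and S: "pointed_simplex c P S" "x \<in> rel_interior (convex hull S)"
    and sub: "negative_vertices q T \<subseteq> S" "S \<subseteq> T"
  shows "eventually (\<lambda>e. (1 - e) *\<^sub>R x + e *\<^sub>R q \<in> rel_interior (convex hull T)) (at_right 0)"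
proof -
  note props = full_simplex_props[OF P T] and b = full_simplex_barycentric[OF P q T]
  obtain w where w: "\<forall>v\<in>S. 0 < w v" "sum w S = 1" "(\<Sum>v\<in>S. w v *\<^sub>R v) = x"
    using S pointed_simplex_basic[OF S(1) P] by (auto simp: rel_interior_convex_hull_explicit)
  define u where "u v = (if v \<in> S then w v else 0)" for v
  have "sum u T = sum u S" by (rule sum.mono_neutral_right) (use props sub u_def in auto)
  moreover have "(\<Sum>v\<in>T. u v *\<^sub>R v) = (\<Sum>v\<in>S. u v *\<^sub>R v)"
    by (rule sum.mono_neutral_right) (use props sub u_def in auto)
  ultimately have u: "sum u T = 1" "(\<Sum>v\<in>T. u v *\<^sub>R v) = x"
    using w unfolding u_def by auto
  have "eventually (\<lambda>e. 0 < (1 - e) * u v + e * barycentric q T v) (at_right 0)" if "v \<in> T" for v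
  proof (cases "v \<in> S")
    case True
    have "((\<lambda>e. (1 - e) * u v + e * barycentric q T v) \<longlongrightarrow> (1 - 0) * u v + 0 * barycentric q T v)
        (at_right 0)"
      by (intro tendsto_intros)
    then show ?thesis
      using w(1) True unfolding u_def by (intro order_tendstoD(1)[of _ "w v"]) auto
  next
    case False
    then have "0 < barycentric q T v"
      using sub(1) b(3)[OF that] that unfolding negative_vertices_def by force
    then show ?thesis
      using False unfolding u_def by (auto intro: eventually_at_right_less[THEN eventually_mono])
  qed
  then have "eventually (\<lambda>e. \<forall>v\<in>T. 0 < (1 - e) * u v + e * barycentric q T v) (at_right 0)"
    using props(3) by (simp add: eventually_ball_finite_distrib)
  then show ?thesis
    by (simp add: rel_interior_simplex_segment[OF P q T u])
qed

text \<open>Finitely many open simplices cover the segment from \<open>x\<close> to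
  \<open>q\<close>, so one of them, \<open>T\<close>, is met for arbitrarily small \<open>e\<close>.
  Two such points put \<open>q\<close> into \<open>affine hull T\<close>, and genericity makes
  \<open>T\<close> full-dimensional. As \<open>convex hull T\<close> is closed it contains
  \<open>x\<close>, and disjointness identifies \<open>S\<close> with the face of \<open>T\<close>
  carrying \<open>x\<close>.\<close>

lemma segment_meets_full_simplex:
  assumes P: "admissible c P" and q: "generic_point c P q" and S: "pointed_simplex c P S"
  shows "\<exists>T\<in>full_simplexes c P. negative_vertices q T \<subseteq> S \<and> S \<subseteq> T"
proof -
  let ?p = "\<lambda>x e. (1 - e) *\<^sub>R x + e *\<^sub>R q"
  have convP: "convex P" using P unfolding admissible_def by (simp add: polytope_imp_convex)
  have qP: "q \<in> P" using q unfolding generic_point_def by blast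
  have Sb: "S \<subseteq> P" "S \<noteq> {}" "\<not> affine_dependent S" using pointed_simplex_basic[OF S P] by auto
  obtain x where x: "x \<in> rel_interior (convex hull S)"
    using Sb(2) rel_interior_eq_empty[of "convex hull S"] by auto
  have xP: "x \<in> P" using x rel_interior_subset Sb(1) convP hull_minimal by blast
  have small: "eventually (\<lambda>e. e \<in> {0<..<1}) (at_right (0::real))"
    by (rule eventually_at_right_real) simp
  have "eventually (\<lambda>e. \<exists>T\<in>{T. pointed_simplex c P T}. ?p x e \<in> rel_interior (convex hull T)) (at_right 0)"
    using small
  proof (rule eventually_mono)
    fix e :: real assume "e \<in> {0<..<1}"
    then have "?p x e \<in> P" using convP xP qP by (auto simp: convex_alt)
    then show "\<exists>T\<in>{T. pointed_simplex c P T}. ?p x e \<in> rel_interior (convex hull T)"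
      using pointed_simplexes_cover[OF P] by blast
  qed
  then have "frequently (\<lambda>e. \<exists>T\<in>{T. pointed_simplex c P T}. ?p x e \<in> rel_interior (convex hull T))
      (at_right 0)"
    by (rule eventually_frequently[OF trivial_limit_at_right_real])
  then have "\<exists>T\<in>{T. pointed_simplex c P T}.
      frequently (\<lambda>e. ?p x e \<in> rel_interior (convex hull T)) (at_right 0)"
    by (rule frequently_bex_finite[OF finite_pointed_simplexes[OF P]])
  then obtain T where T: "pointed_simplex c P T"
    and freq: "frequently (\<lambda>e. ?p x e \<in> rel_interior (convex hull T)) (at_right 0)"
    by blast
  have Tb: "\<not> affine_dependent T" "finite T" "T \<subseteq> P"
    using pointed_simplex_basic[OF T P] pointed_simplex_finite[OF T] by auto
  have "frequently (\<lambda>e. ?p x e \<in> rel_interior (convex hull T) \<and> e \<in> {0<..<1}) (at_right 0)"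
    using frequently_eventually_frequently[OF freq small] .
  then obtain e where e: "?p x e \<in> rel_interior (convex hull T)" "0 < e" "e < 1"
    using frequently_ex by force
  have "eventually (\<lambda>d. d \<in> {0<..<e}) (at_right (0::real))"
    by (rule eventually_at_right_real) (rule e)
  then have "frequently (\<lambda>d. ?p x d \<in> rel_interior (convex hull T) \<and> d \<in> {0<..<e}) (at_right 0)"
    using frequently_eventually_frequently[OF freq] by blast
  then obtain d where d: "?p x d \<in> rel_interior (convex hull T)" "0 < d" "d < e"
    using frequently_ex by force
  have sub: "rel_interior (convex hull T) \<subseteq> affine hull T"
    using rel_interior_subset convex_hull_subset_affine_hull by blast
  have qT: "q \<in> affine hull T"
    using affine_contains_line[of "affine hull T" d x q e 1] sub d e by auto
  have "aff_dim P < int (card T)" using generic_point_card[OF q T subset_refl qT] .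
  moreover have "int (card T) \<le> aff_dim P + 1"
    using aff_dim_affine_independent[OF Tb(1)] aff_dim_subset[OF Tb(3)] by simp
  ultimately have full: "T \<in> full_simplexes c P" using T unfolding full_simplexes_def by auto
  have "x \<in> convex hull T"
  proof (rule ccontr)
    assume "x \<notin> convex hull T"
    then have "x \<in> - (convex hull T)" "open (- (convex hull T))"
      using Tb(2) by (auto intro: compact_imp_closed finite_imp_compact_convex_hull)
    moreover have "((\<lambda>e. ?p x e) \<longlongrightarrow> (1 - 0) *\<^sub>R x + 0 *\<^sub>R q) (at_right 0)"
      by (intro tendsto_intros)
    then have "((\<lambda>e. ?p x e) \<longlongrightarrow> x) (at_right 0)" by simp
    ultimately have "eventually (\<lambda>e. ?p x e \<in> - (convex hull T)) (at_right 0)"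
      by (intro topological_tendstoD)
    then have "frequently (\<lambda>e. ?p x e \<in> rel_interior (convex hull T) \<and> ?p x e \<in> - (convex hull T))
        (at_right 0)"
      using frequently_eventually_frequently[OF freq] by blast
    then obtain e where "?p x e \<in> rel_interior (convex hull T)" "?p x e \<in> - (convex hull T)"
      using frequently_ex by force
    then show False using rel_interior_subset[of "convex hull T"] by blast
  qed
  then obtain u where u: "\<forall>v\<in>T. 0 \<le> u v" "sum u T = 1" "(\<Sum>v\<in>T. u v *\<^sub>R v) = x"
    using convex_hull_finite[OF Tb(2)] by auto
  define U where "U = {v \<in> T. 0 < u v}"
  have "sum u T = sum u U"
    by (rule sum.mono_neutral_right) (use Tb u in \<open>auto simp: U_def order.order_iff_strict\<close>)
  moreover have "(\<Sum>v\<in>T. u v *\<^sub>R v) = (\<Sum>v\<in>U. u v *\<^sub>R v)"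
    by (rule sum.mono_neutral_right) (use Tb u in \<open>auto simp: U_def order.order_iff_strict\<close>)
  ultimately have U: "sum u U = 1" "(\<Sum>v\<in>U. u v *\<^sub>R v) = x" using u by auto
  then have "U \<noteq> {}" by auto
  then have US: "pointed_simplex c P U"
    by (intro pointed_simplex_subset[OF T]) (auto simp: U_def)
  have "x \<in> rel_interior (convex hull U)"
    by (subst mem_rel_interior_simplex_iff[OF _ U])
      (use pointed_simplex_basic[OF US P] in \<open>auto simp: U_def\<close>)
  then have "U = S" using pointed_simplexes_disjoint[OF P] US S x by blast
  moreover have "negative_vertices q T \<subseteq> U"
  proof
    fix v assume v: "v \<in> negative_vertices q T"
    then have vT: "v \<in> T" "barycentric q T v < 0" unfolding negative_vertices_def by auto
    \<comment> \<open>This coordinate belongs to a point of the open simplex; as \<open>q\<close>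
      contributes negatively, \<open>x\<close> must contribute positively.\<close>
    have "0 < (1 - e) * u v + e * barycentric q T v"
      using e(1) vT(1) rel_interior_simplex_segment[OF P q full u(2,3), of e] by blast
    moreover have "e * barycentric q T v < 0" using vT(2) e(2) by (simp add: mult_pos_neg)
    ultimately have "0 < (1 - e) * u v" by linarith
    then show "v \<in> U" unfolding U_def using vT(1) e(3) by (simp add: zero_less_mult_iff)
  qed
  moreover have "U \<subseteq> T" unfolding U_def by auto
  ultimately show ?thesis using full by (intro bexI[of _ T]) simp_all
qed

text \<open>For uniqueness: two candidates would share the points near \<open>x\<close> on the
  segment towards \<open>q\<close> in their relative interiors, contrary to disjointness.\<close>

lemma half_open_decomposition:
  assumes P: "admissible c P" and q: "generic_point c P q" and S: "pointed_simplex c P S"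
  shows "\<exists>!T. T \<in> full_simplexes c P \<and> negative_vertices q T \<subseteq> S \<and> S \<subseteq> T"
proof -
  have Sb: "S \<noteq> {}" using pointed_simplex_basic[OF S P] by auto
  obtain x where x: "x \<in> rel_interior (convex hull S)"
    using Sb rel_interior_eq_empty[of "convex hull S"] by auto
  have "T = T'" if T: "T \<in> full_simplexes c P" "negative_vertices q T \<subseteq> S" "S \<subseteq> T"
    and T': "T' \<in> full_simplexes c P" "negative_vertices q T' \<subseteq> S" "S \<subseteq> T'" for T T'
  proof -
    have "eventually (\<lambda>e. (1 - e) *\<^sub>R x + e *\<^sub>R q \<in> rel_interior (convex hull T) \<and>
        (1 - e) *\<^sub>R x + e *\<^sub>R q \<in> rel_interior (convex hull T')) (at_right 0)"
      using eventually_segment_in_simplex[OF P q T(1) S x T(2,3)]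
        eventually_segment_in_simplex[OF P q T'(1) S x T'(2,3)]
      by (rule eventually_conj)
    then obtain e where "(1 - e) *\<^sub>R x + e *\<^sub>R q \<in> rel_interior (convex hull T)"
      "(1 - e) *\<^sub>R x + e *\<^sub>R q \<in> rel_interior (convex hull T')"
      using eventually_happens'[OF trivial_limit_at_right_real] by force
    then show ?thesis
      using pointed_simplexes_disjoint[OF P, rule_format, of T T'] full_simplex_props(1)[OF P T(1)]
        full_simplex_props(1)[OF P T'(1)] by simp
  qed
  then show ?thesis
    using segment_meets_full_simplex[OF P q S] by (intro ex_ex1I) blast+
qed

text \<open>As no coordinate of \<open>q\<close> vanishes, having none negative means that
  \<open>q\<close> lies in the open simplex. Exactly one open simplex contains \<open>q\<close>, and
  genericity makes it full-dimensional.\<close>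

lemma card_no_negative_vertices:
  assumes P: "admissible c P" and q: "generic_point c P q"
  shows "card {T \<in> full_simplexes c P. negative_vertices q T = {}} = 1"
proof -
  have qP: "q \<in> P" using q unfolding generic_point_def by blast
  obtain T where T: "pointed_simplex c P T" "q \<in> rel_interior (convex hull T)"
    using pointed_simplexes_cover[OF P] qP by blast
  have Tb: "\<not> affine_dependent T" "T \<subseteq> P" using pointed_simplex_basic[OF T(1) P] by auto
  have "q \<in> affine hull T"
    using T(2) rel_interior_subset convex_hull_subset_affine_hull by blast
  then have "aff_dim P < int (card T)" using generic_point_card[OF q T(1)] by simp
  moreover have "int (card T) \<le> aff_dim P + 1"
    using aff_dim_affine_independent[OF Tb(1)] aff_dim_subset[OF Tb(2)] by simp
  ultimately have full: "T \<in> full_simplexes c P" using T unfolding full_simplexes_def by auto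
  have iff: "negative_vertices q T' = {} \<longleftrightarrow> q \<in> rel_interior (convex hull T')"
    if T': "T' \<in> full_simplexes c P" for T'
  proof -
    note b = full_simplex_barycentric[OF P q T']
    show ?thesis
      unfolding mem_rel_interior_simplex_iff[OF full_simplex_props(2)[OF P T'] b(1,2)]
      using b(3) unfolding negative_vertices_def by force
  qed
  have "{T \<in> full_simplexes c P. negative_vertices q T = {}} = {T}"
  proof (intro equalityI subsetI)
    fix T' assume "T' \<in> {T \<in> full_simplexes c P. negative_vertices q T = {}}"
    then have "pointed_simplex c P T'" "q \<in> rel_interior (convex hull T')"
      using iff full_simplex_props(1)[OF P] by auto
    then show "T' \<in> {T}" using T pointed_simplexes_disjoint[OF P, rule_format, of T' T] by simp
  qed (use iff full T in auto)
  then show ?thesis by simp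
qed

text \<open>
  Otherwise \<open>T\<close> has a single vertex \<open>w\<close> with positive coordinate, which makes \<open>w\<close> a proper convex
  combination of \<open>q\<close> and a point of the opposite face, although \<open>w\<close> is a vertex of \<open>P\<close>.
\<close>

lemma card_negative_vertices:
  assumes P: "admissible c P" and q: "generic_point c P q" and T: "T \<in> full_simplexes c P"
    and d: "0 < aff_dim P"
  shows "int (card (negative_vertices q T)) < aff_dim P"
proof (rule ccontr)
  assume large: "\<not> int (card (negative_vertices q T)) < aff_dim P"
  define R where "R = negative_vertices q T"
  let ?b = "barycentric q T"
  note props = full_simplex_props[OF P T] and b = full_simplex_barycentric[OF P q T]
  have R: "R \<subseteq> T" "finite R" "\<And>v. v \<in> R \<Longrightarrow> ?b v < 0"
    using props(3) unfolding R_def negative_vertices_def by auto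
  have "R \<noteq> T"
  proof
    assume "R = T"
    then have "sum ?b T \<le> 0" using R by (intro sum_nonpos) (auto simp: less_imp_le)
    then show False using b(1) by simp
  qed
  then have "card R < card T" using R props(3) by (simp add: psubset_card_mono psubsetI)
  moreover have "aff_dim P \<le> int (card R)" "int (card T) = aff_dim P + 1"
    using large T unfolding R_def full_simplexes_def by auto
  ultimately have "card T = Suc (card R)" by linarith
  then have "card (T - R) = 1"
    using R by (simp add: card_Diff_subset)
  then obtain w where w: "T - R = {w}" by (meson card_1_singletonE)
  have wT: "w \<in> T" "w \<notin> R" "T = insert w R" using w R(1) by auto
  \<comment> \<open>Dividing the negated coordinates on \<open>R\<close> by their sum
    \<open>s\<close> gives a convex combination \<open>p\<close>, and the coordinates of
    \<open>q\<close> turn into \<open>(1 + s) w = q + s p\<close>. Positive dimension makes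
    \<open>R\<close> nonempty, so \<open>s\<close> is positive.\<close>
  define s where "s = (\<Sum>v\<in>R. - ?b v)"
  define p where "p = (\<Sum>v\<in>R. (- ?b v / s) *\<^sub>R v)"
  have "R \<noteq> {}" using large d unfolding R_def by auto
  then have s: "0 < s" unfolding s_def using R by (intro sum_pos) auto
  have "(\<Sum>v\<in>R. - ?b v / s) = 1"
    unfolding sum_divide_distrib[symmetric] s_def[symmetric] using s by simp
  moreover have "0 \<le> - ?b v / s" if "v \<in> R" for v
    using R(3)[OF that] s by (intro divide_nonneg_pos) auto
  ultimately have "p \<in> P"
    unfolding p_def using R(1,2) props(4) P
    by (intro convex_sum) (auto simp: admissible_def polytope_imp_convex)
  have bw: "?b w = 1 + s" using b(1) wT R(2) unfolding s_def by (simp add: sum_negf)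
  have "q = ?b w *\<^sub>R w + (\<Sum>v\<in>R. ?b v *\<^sub>R v)" using b(2) wT R(2) by simp
  also have "(\<Sum>v\<in>R. ?b v *\<^sub>R v) = - (s *\<^sub>R p)"
    unfolding p_def using s by (simp add: scaleR_sum_right sum_negf)
  finally have qw: "(1 + s) *\<^sub>R w = q + s *\<^sub>R p" unfolding bw by simp
  have qw': "w \<noteq> q"
  proof
    assume "w = q"
    then have "q \<in> affine hull {w}" by simp
    then have "aff_dim P < int (card {w})"
      using generic_point_card[OF q props(1), of "{w}"] wT(1) by blast
    then show False using d by simp
  qed
  have "q \<noteq> p"
  proof
    assume "q = p"
    then have "(1 + s) *\<^sub>R w = (1 + s) *\<^sub>R q" using qw by (simp add: algebra_simps)
    then show False using s qw' by simp
  qed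
  moreover have "w = (1 - s / (1 + s)) *\<^sub>R q + (s / (1 + s)) *\<^sub>R p"
  proof -
    have "w = (1 / (1 + s)) *\<^sub>R ((1 + s) *\<^sub>R w)" using s by simp
    also have "\<dots> = (1 / (1 + s)) *\<^sub>R q + (s / (1 + s)) *\<^sub>R p"
      unfolding qw by (simp add: scaleR_right_distrib)
    also have "1 / (1 + s) = 1 - s / (1 + s)" using s by (simp add: field_simps)
    finally show ?thesis .
  qed
  moreover have "0 < s / (1 + s)" "s / (1 + s) < 1" using s by auto
  ultimately have "w \<in> open_segment q p" unfolding in_segment by blast
  moreover have "w extreme_point_of P"
    using pointed_simplex_extreme_points[OF props(1) P wT(1)] .
  moreover have "q \<in> P" using q unfolding generic_point_def by blast
  ultimately show False using \<open>p \<in> P\<close> unfolding extreme_point_of_def by blast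
qed

text \<open>Group the simplices by the full-dimensional one assigned to them. Each group is an
  interval of vertex sets, whose weights add up to a single binomial.\<close>

lemma polytope_number_eq_sum_simplex_numbers:
  assumes P: "admissible c P" and d: "aff_dim P = int d" and q: "generic_point c P q"
    and n: "2 \<le> n"
  shows "polytope_number c P n =
    (\<Sum>T\<in>full_simplexes c P. simplex_number d (int n - int (card (negative_vertices q T))))"
proof -
  let ?f = "\<lambda>S. int (compositions (n - 2) (card S))"
  let ?I = "\<lambda>T. {S. negative_vertices q T \<subseteq> S \<and> S \<subseteq> T}"
  let ?M = "full_simplexes c P"
  have finM: "finite ?M"
    by (rule finite_subset[OF _ finite_pointed_simplexes[OF P]]) (auto simp: full_simplexes_def)
  have finI: "finite (?I T)" if "T \<in> ?M" for T
    by (rule finite_subset[of _ "Pow T"]) (use full_simplex_props(3)[OF P that] in auto)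
  \<comment> \<open>The empty set lies in the interval when \<open>T\<close> has no negative
    vertices, but it is no \<open>pointed_simplex\<close>.\<close>
  have K: "{S. pointed_simplex c P S} = (\<Union>T\<in>?M. ?I T - {{}})"
  proof (intro equalityI subsetI)
    fix S assume "S \<in> {S. pointed_simplex c P S}"
    then have S: "pointed_simplex c P S" by simp
    then show "S \<in> (\<Union>T\<in>?M. ?I T - {{}})"
      using segment_meets_full_simplex[OF P q S] pointed_simplex_basic[OF S P] by auto
  next
    fix S assume "S \<in> (\<Union>T\<in>?M. ?I T - {{}})"
    then obtain T where "T \<in> ?M" "S \<subseteq> T" "S \<noteq> {}" by blast
    then show "S \<in> {S. pointed_simplex c P S}"
      using pointed_simplex_subset[OF full_simplex_props(1)[OF P]] by simp
  qed
  have disj: "(?I T - {{}}) \<inter> (?I T' - {{}}) = {}" if "T \<in> ?M" "T' \<in> ?M" "T \<noteq> T'" for T T'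
  proof (rule ccontr)
    assume "\<not> ?thesis"
    then obtain S where S: "S \<in> ?I T" "S \<in> ?I T'" "S \<noteq> {}" by blast
    then have "pointed_simplex c P S"
      using pointed_simplex_subset[OF full_simplex_props(1)[OF P that(1)], of S] by simp
    then have "\<exists>!T. T \<in> full_simplexes c P \<and> negative_vertices q T \<subseteq> S \<and> S \<subseteq> T"
      by (rule half_open_decomposition[OF P q])
    then show False using S that by (metis (mono_tags, lifting) mem_Collect_eq)
  qed
  have "polytope_number c P n = (\<Sum>S | pointed_simplex c P S. ?f S)"
    using polytope_numbers_eq_sum[OF P] n by blast
  also have "\<dots> = (\<Sum>T\<in>?M. \<Sum>S\<in>?I T - {{}}. ?f S)"
    unfolding K using finM finI disj by (intro sum.UNION_disjoint) auto
  also have "\<dots> = (\<Sum>T\<in>?M. simplex_number d (int n - int (card (negative_vertices q T))))"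
  proof (rule sum.cong[OF refl])
    fix T assume T: "T \<in> ?M"
    define R where "R = negative_vertices q T"
    have R: "R \<subseteq> T" "finite T" "finite R" "card T = Suc d"
      using full_simplex_props(3)[OF P T] T d
      by (auto simp: R_def negative_vertices_def full_simplexes_def)
    then have cards: "card R \<le> Suc d" "card (T - R) = Suc d - card R" "R \<union> (T - R) = T"
      using card_mono[OF R(2,1)] by (auto simp: card_Diff_subset)
    \<comment> \<open>The empty set has weight 0, so the full interval may be summed.\<close>
    have "(\<Sum>S\<in>?I T - {{}}. ?f S) = (\<Sum>S\<in>?I T. ?f S)"
      by (rule sum.mono_neutral_left) (use finI[OF T] in \<open>auto simp: compositions_def\<close>)
    also have "\<dots> = int (\<Sum>S | R \<subseteq> S \<and> S \<subseteq> R \<union> (T - R). compositions (n - 2) (card S))"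
      unfolding cards(3) R_def[symmetric] by simp
    also have "\<dots> = int (compositions (n - 2 + (Suc d - card R)) (Suc d))"
      using R cards by (subst sum_compositions_interval) auto
    also have "\<dots> = simplex_number d (int n - int (card R))"
      by (rule compositions_simplex_number[OF n cards(1)])
    finally show "(\<Sum>S\<in>?I T - {{}}. ?f S) = simplex_number d (int n - int (card (negative_vertices q T)))"
      unfolding R_def .
  qed
  finally show ?thesis .
qed

theorem theorem4p1:
  fixes P :: "'a::euclidean_space set" and c :: 'a and d :: nat and C :: "'a set set"
  assumes "polytope P"
    and "aff_dim P = int d"
    and "generic_on c P"
    and "C = pointed_triangulation c P"
  shows "\<exists>a :: nat \<Rightarrow> nat. \<forall>n :: nat.
           polytope_number c P n =
             simplex_number d (int n) +
             (\<Sum>i = 1..d - 1. int (a i) * simplex_number d (int n - int i))"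
proof (cases "d = 0")
  case True
  \<comment> \<open>For a point the index range is empty, and \<open>simplex_number 0\<close> is 1
    at positive arguments and 0 elsewhere.\<close>
  have "P \<noteq> {}" using assms(2) by auto
  then show ?thesis
    using assms(1-3) True
    by (intro exI allI, subst polytope_number.simps) (auto simp: simplex_number_def)
next
  case False
  have P: "admissible c P" using assms unfolding admissible_def by auto
  obtain q where q: "generic_point c P q" using generic_point_exists[OF P] by blast
  let ?M = "full_simplexes c P" and ?r = "\<lambda>T. card (negative_vertices q T)"
  define a where "a i = card {T \<in> ?M. ?r T = i}" for i
  have finM: "finite ?M"
    by (rule finite_subset[OF _ finite_pointed_simplexes[OF P]]) (auto simp: full_simplexes_def)
  have "?r T = 0 \<longleftrightarrow> negative_vertices q T = {}" if "T \<in> ?M" for T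
    using full_simplex_props(3)[OF P that] by (auto simp: negative_vertices_def)
  then have "{T \<in> ?M. ?r T = 0} = {T \<in> ?M. negative_vertices q T = {}}" by auto
  then have a0: "a 0 = 1" unfolding a_def using card_no_negative_vertices[OF P q] by simp
  have r: "?r ` ?M \<subseteq> {0..d - 1}"
    using card_negative_vertices[OF P q] False assms(2) by fastforce
  show ?thesis
  proof (intro exI allI)
    fix n :: nat
    \<comment> \<open>The formula by simplices starts at \<open>n = 2\<close>. For smaller
      \<open>n\<close> the shifted terms vanish, their arguments not being positive.\<close>
    consider "n = 0" | "n = 1" | "2 \<le> n" by linarith
    then show "polytope_number c P n = simplex_number d (int n) +
        (\<Sum>i = 1..d - 1. int (a i) * simplex_number d (int n - int i))"
    proof cases
      case 1
      have "polytope_number c P 0 = 0" by (subst polytope_number.simps) auto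
      then show ?thesis using 1 by (simp add: simplex_number_def)
    next
      case 2
      then show ?thesis using polytope_number_1[OF P] by (simp add: simplex_number_def)
    next
      case 3
      have "polytope_number c P n = (\<Sum>T\<in>?M. simplex_number d (int n - int (?r T)))"
        by (rule polytope_number_eq_sum_simplex_numbers[OF P assms(2) q 3])
      \<comment> \<open>Collect the full-dimensional simplices by their number of negative vertices;
        \<open>a 0 = 1\<close> then yields the leading term.\<close>
      also have "\<dots> = (\<Sum>i\<in>{0..d - 1}. \<Sum>T | T \<in> ?M \<and> ?r T = i. simplex_number d (int n - int (?r T)))"
        using finM r by (intro sum.group[symmetric]) auto
      also have "\<dots> = (\<Sum>i\<in>{0..d - 1}. int (a i) * simplex_number d (int n - int i))"
        unfolding a_def by (intro sum.cong) auto
      also have "\<dots> = simplex_number d (int n) +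
          (\<Sum>i = 1..d - 1. int (a i) * simplex_number d (int n - int i))"
        using a0 by (subst sum.atLeast_Suc_atMost) auto
      finally show ?thesis .
    qed
  qed
qed

end
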